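(* Let $m\ge2$ be an integer. Then $$r_{\mathrm{opt}}(m,\ell_1)=\frac2m,\qquad r_{\mathrm{opt}}(m,\ell_2)=\frac2{m+1}.$$ In particular, although both $\ell_1$ and $\ell_2$ have cotype $2$, $r_{\mathrm{opt}}(m,\ell_1)\ne r_{\mathrm{opt}}(m,\ell_2)$.
   Context: All Banach spaces are over a fixed field $\mathbb K\in\{\mathbb R,\mathbb C\}$. $\mathcal L({}^mE;F)$ denotes the space of continuous $m$-linear maps $E\times\cdots\times E\to F$ with the usual operator norm. The weak $1$-norm of a finite family $(x_j)_{j=1}^N$ in a Banach space $E$ is $\|(x_j)_{j=1}^N\|_{w,1}=\sup_{\varphi\in B_{E^*}}\sum_{j=1}^N|\varphi(x_j)|$, where $B_{E^*}$ is the closed unit ball of the dual. For $0<r<\infty$, an operator $T\in\mathcal L({}^mE;F)$ is absolutely $(r;1)$-summing if there is $C\ge0$ such that $$\Bigl(\sum_{j=1}^N\|T(x_j^{(1)},\ldots,x_j^{(m)})\|^r\Bigr)^{1/r}\le C\prod_{q=1}^m\|(x_j^{(q)})_{j=1}^N\|_{w,1}$$ for every $N\in\mathbb N$ and all finite families $(x_j^{(q)})_{j=1}^N\subset E$, $1\le q\le m$. The class of such maps is $\mathcal L_{\mathrm{as}(r;1)}({}^mE;F)$. For a Banach space $F$, the optimal coincidence exponent is $$r_{\mathrm{opt}}(m,F):=\inf\bigl\{r>0:\ \mathcal L({}^m\ell_1;F)=\mathcal L_{\mathrm{as}(r;1)}({}^m\ell_1;F)\bigr\}.$$ *)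

theory Defs
  imports "HOL-Analysis.Analysis"
begin

section \<open>Banach spaces over a scalar field\<close>

text \<open>
  The type classes of the library only know real scalars. A Banach space over the field \<open>'k\<close>
  (below: \<^typ>\<open>real\<close> or \<^typ>\<open>complex\<close>) is a type of class \<^class>\<open>banach\<close> together with an explicit
  scalar multiplication by \<open>'k\<close> that is compatible with the norm and with the real scalars of the
  class.
\<close>

locale banach_space_over = vector_space scale
  for scale :: "'k::{real_normed_field,banach} \<Rightarrow> 'a::banach \<Rightarrow> 'a" +
  assumes norm_scale: "norm (scale c x) = norm c * norm x"
    and scale_of_real: "scale (of_real r) x = r *\<^sub>R x"


section \<open>The sequence space \<open>\<ell>\<^sub>1\<close>\<close>

typedef (overloaded) ('k::real_normed_field) ell1 =
  "{x :: nat \<Rightarrow> 'k. summable (\<lambda>n. norm (x n))}"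
  morphisms ell1_nth Ell1
  by (rule exI[of _ "\<lambda>_. 0"]) simp

setup_lifting type_definition_ell1

lemma ell1_eqI: "(\<And>n. ell1_nth x n = ell1_nth y n) \<Longrightarrow> x = y"
  by (metis ell1_nth_inject ext)

lemma summable_norm_diff1:
  fixes x y :: "nat \<Rightarrow> 'k::real_normed_field"
  assumes "summable (\<lambda>n. norm (x n))" "summable (\<lambda>n. norm (y n))"
  shows "summable (\<lambda>n. norm (x n - y n))"
  by (rule summable_comparison_test'[OF summable_add[OF assms]]) (simp add: norm_triangle_ineq4)

lemma summable_norm_add1:
  fixes x y :: "nat \<Rightarrow> 'k::real_normed_field"
  assumes "summable (\<lambda>n. norm (x n))" "summable (\<lambda>n. norm (y n))"
  shows "summable (\<lambda>n. norm (x n + y n))"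
  by (rule summable_comparison_test'[OF summable_add[OF assms]]) (simp add: norm_triangle_ineq)

instantiation ell1 :: (real_normed_field) real_vector
begin

lift_definition zero_ell1 :: "'a ell1" is "\<lambda>_. 0" by simp
lift_definition plus_ell1 :: "'a ell1 \<Rightarrow> 'a ell1 \<Rightarrow> 'a ell1" is "\<lambda>x y n. x n + y n"
  by (rule summable_norm_add1)
lift_definition minus_ell1 :: "'a ell1 \<Rightarrow> 'a ell1 \<Rightarrow> 'a ell1" is "\<lambda>x y n. x n - y n"
  by (rule summable_norm_diff1)
lift_definition uminus_ell1 :: "'a ell1 \<Rightarrow> 'a ell1" is "\<lambda>x n. - x n" by simp
lift_definition scaleR_ell1 :: "real \<Rightarrow> 'a ell1 \<Rightarrow> 'a ell1" is "\<lambda>r x n. r *\<^sub>R x n"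
  by (simp add: summable_mult)

instance
  by standard (transfer; simp add: algebra_simps fun_eq_iff)+

end

lemmas ell1_nth_simps [simp] =
  zero_ell1.rep_eq plus_ell1.rep_eq minus_ell1.rep_eq uminus_ell1.rep_eq scaleR_ell1.rep_eq

lemma ell1_summable: "summable (\<lambda>n. norm (ell1_nth x n))"
  using ell1_nth[of x] by simp

instantiation ell1 :: (real_normed_field) real_normed_vector
begin

definition norm_ell1 :: "'a ell1 \<Rightarrow> real"
  where "norm x = (\<Sum>n. norm (ell1_nth x n))"

definition sgn_ell1 :: "'a ell1 \<Rightarrow> 'a ell1"
  where "sgn_ell1 x = inverse (norm x) *\<^sub>R x"

definition dist_ell1 :: "'a ell1 \<Rightarrow> 'a ell1 \<Rightarrow> real"
  where "dist_ell1 x y = norm (x - y)"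

definition uniformity_ell1 :: "('a ell1 \<times> 'a ell1) filter"
  where "uniformity_ell1 = (INF e\<in>{0<..}. principal {(x, y). dist x y < e})"

definition open_ell1 :: "'a ell1 set \<Rightarrow> bool"
  where "open_ell1 S = (\<forall>x\<in>S. \<forall>\<^sub>F (x', y) in uniformity. x' = x \<longrightarrow> y \<in> S)"

instance
proof
  fix x y :: "'a ell1" and r :: real and S :: "'a ell1 set"
  show "dist x y = norm (x - y)" by (fact dist_ell1_def)
  show "sgn x = inverse (norm x) *\<^sub>R x" by (fact sgn_ell1_def)
  show "uniformity = (INF e\<in>{0<..}. principal {(x :: 'a ell1, y). dist x y < e})"
    by (fact uniformity_ell1_def)
  show "open S = (\<forall>x\<in>S. \<forall>\<^sub>F (x', y) in uniformity. x' = x \<longrightarrow> y \<in> S)"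
    by (fact open_ell1_def)
  show "norm x = 0 \<longleftrightarrow> x = 0"
    unfolding norm_ell1_def using suminf_eq_zero_iff[OF ell1_summable[of x]]
    by (auto intro: ell1_eqI)
  show "norm (r *\<^sub>R x) = \<bar>r\<bar> * norm x"
    unfolding norm_ell1_def by (simp add: suminf_mult[OF ell1_summable])
  show "norm (x + y) \<le> norm x + norm y"
    unfolding norm_ell1_def suminf_add[OF ell1_summable ell1_summable]
    by (rule suminf_le[OF _ ell1_summable summable_add[OF ell1_summable ell1_summable]])
      (simp add: norm_triangle_ineq)
qed

end

lemma ell1_sum_le_norm: "(\<Sum>n<N. norm (ell1_nth x n)) \<le> norm x"
  unfolding norm_ell1_def by (rule sum_le_suminf[OF ell1_summable]) auto

lemma ell1_nth_le_norm: "norm (ell1_nth x n) \<le> norm x"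
  by (rule order_trans[OF _ ell1_sum_le_norm[of x "Suc n"]]) (simp add: sum_nonneg)

lemma Ell1_bounded:
  fixes a :: "nat \<Rightarrow> 'k::real_normed_field"
  assumes "\<And>N. (\<Sum>n<N. norm (a n)) \<le> C"
  shows "ell1_nth (Ell1 a) = a" "norm (Ell1 a) \<le> C"
proof -
  have s: "summable (\<lambda>n. norm (a n))"
    by (rule summableI_nonneg_bounded) (use assms in auto)
  then show *: "ell1_nth (Ell1 a) = a" by (simp add: Ell1_inverse)
  show "norm (Ell1 a) \<le> C"
    unfolding norm_ell1_def * by (rule suminf_le_const[OF s assms])
qed

instance ell1 :: ("{real_normed_field,banach}") banach
proof
  fix X :: "nat \<Rightarrow> 'a ell1"
  assume C: "Cauchy X"
  have "Cauchy (\<lambda>k. ell1_nth (X k) n)" for n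
  proof (rule metric_CauchyI)
    fix e :: real assume "0 < e"
    then obtain M where M: "\<forall>i\<ge>M. \<forall>j\<ge>M. dist (X i) (X j) < e"
      using C unfolding Cauchy_def by blast
    have "dist (ell1_nth (X i) n) (ell1_nth (X j) n) < e" if "i \<ge> M" "j \<ge> M" for i j
      using M that ell1_nth_le_norm[of "X i - X j" n]
      by (simp add: dist_norm) (meson le_less_trans)
    then show "\<exists>M. \<forall>m\<ge>M. \<forall>k\<ge>M. dist (ell1_nth (X m) n) (ell1_nth (X k) n) < e" by blast
  qed
  then have "\<forall>n. \<exists>l. (\<lambda>k. ell1_nth (X k) n) \<longlonglongrightarrow> l"
    using Cauchy_convergent convergent_def by blast
  then obtain a where a: "\<And>n. (\<lambda>k. ell1_nth (X k) n) \<longlonglongrightarrow> a n" by metis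
  have tail: "(\<Sum>n<N. norm (ell1_nth (X i) n - a n)) \<le> e"
    if M: "\<forall>i\<ge>M. \<forall>j\<ge>M. dist (X i) (X j) < e" and "i \<ge> M" for i M N and e :: real
  proof (rule LIMSEQ_le_const2)
    show "(\<lambda>j. \<Sum>n<N. norm (ell1_nth (X i) n - ell1_nth (X j) n))
        \<longlonglongrightarrow> (\<Sum>n<N. norm (ell1_nth (X i) n - a n))"
      by (intro tendsto_intros a)
    show "\<exists>M. \<forall>j\<ge>M. (\<Sum>n<N. norm (ell1_nth (X i) n - ell1_nth (X j) n)) \<le> e"
    proof (intro exI allI impI)
      fix j assume "j \<ge> M"
      then have "norm (X i - X j) \<le> e" using M \<open>i \<ge> M\<close> by (force simp: dist_norm)
      then show "(\<Sum>n<N. norm (ell1_nth (X i) n - ell1_nth (X j) n)) \<le> e"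
        using ell1_sum_le_norm[of "X i - X j" N] by simp
    qed
  qed
  obtain M1 where M1: "\<forall>i\<ge>M1. \<forall>j\<ge>M1. dist (X i) (X j) < 1"
    using C zero_less_one unfolding Cauchy_def by blast
  define L where "L = X M1 - Ell1 (\<lambda>n. ell1_nth (X M1) n - a n)"
  have L: "ell1_nth L = a"
    unfolding L_def using Ell1_bounded(1)[OF tail[OF M1 order_refl]] by (simp add: fun_eq_iff)
  have "X \<longlonglongrightarrow> L"
  proof (rule metric_LIMSEQ_I)
    fix e :: real assume "0 < e"
    then have "0 < e / 2" by simp
    then obtain M where M: "\<forall>i\<ge>M. \<forall>j\<ge>M. dist (X i) (X j) < e / 2"
      using C unfolding Cauchy_def by blast
    have "dist (X i) L < e" if "i \<ge> M" for i
    proof -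
      have "X i - L = Ell1 (\<lambda>n. ell1_nth (X i) n - a n)"
        by (rule ell1_eqI) (simp add: L Ell1_bounded(1)[OF tail[OF M that]])
      then have "norm (X i - L) \<le> e / 2" using Ell1_bounded(2)[OF tail[OF M that]] by simp
      then show ?thesis using \<open>0 < e\<close> by (simp add: dist_norm)
    qed
    then show "\<exists>M. \<forall>n\<ge>M. dist (X n) L < e" by blast
  qed
  then show "convergent X" unfolding convergent_def by blast
qed

lift_definition scale_ell1 :: "'k::real_normed_field \<Rightarrow> 'k ell1 \<Rightarrow> 'k ell1" is "\<lambda>c x n. c * x n"
  by (simp add: norm_mult summable_mult)

interpretation ell1: banach_space_over "scale_ell1 :: 'k::{real_normed_field,banach} \<Rightarrow> _"
proof
  fix c d :: 'k and x y :: "'k ell1" and r :: real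
  show "scale_ell1 c (x + y) = scale_ell1 c x + scale_ell1 c y"
    by transfer (simp add: algebra_simps)
  show "scale_ell1 (c + d) x = scale_ell1 c x + scale_ell1 d x"
    by transfer (simp add: algebra_simps)
  show "scale_ell1 c (scale_ell1 d x) = scale_ell1 (c * d) x"
    by transfer (simp add: algebra_simps)
  show "scale_ell1 1 x = x"
    by transfer simp
  show "norm (scale_ell1 c x) = norm c * norm x"
    by (simp add: norm_ell1_def scale_ell1.rep_eq norm_mult suminf_mult[OF ell1_summable])
  show "scale_ell1 (of_real r) x = r *\<^sub>R x"
    by transfer (simp add: scaleR_conv_of_real)
qed


section \<open>The sequence space \<open>\<ell>\<^sub>2\<close>\<close>

typedef (overloaded) ('k::real_normed_field) ell2 =
  "{x :: nat \<Rightarrow> 'k. summable (\<lambda>n. (norm (x n))\<^sup>2)}"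
  morphisms ell2_nth Ell2
  by (rule exI[of _ "\<lambda>_. 0"]) simp

setup_lifting type_definition_ell2

lemma ell2_eqI: "(\<And>n. ell2_nth x n = ell2_nth y n) \<Longrightarrow> x = y"
  by (metis ell2_nth_inject ext)

lemma summable_norm_add2:
  fixes x y :: "nat \<Rightarrow> 'k::real_normed_field"
  assumes "summable (\<lambda>n. (norm (x n))\<^sup>2)" "summable (\<lambda>n. (norm (y n))\<^sup>2)"
  shows "summable (\<lambda>n. (norm (x n + y n))\<^sup>2)"
proof (rule summable_comparison_test'[OF summable_mult[OF summable_add[OF assms], of 2]])
  fix n
  have "(norm (x n + y n))\<^sup>2 \<le> (norm (x n) + norm (y n))\<^sup>2"
    by (intro power_mono norm_triangle_ineq) simp
  also have "\<dots> \<le> 2 * ((norm (x n))\<^sup>2 + (norm (y n))\<^sup>2)"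
    using sum_squares_bound[of "norm (x n)" "norm (y n)"] by (simp add: power2_sum)
  finally show "norm ((norm (x n + y n))\<^sup>2) \<le> 2 * ((norm (x n))\<^sup>2 + (norm (y n))\<^sup>2)" by simp
qed

lemma summable_norm_diff2:
  fixes x y :: "nat \<Rightarrow> 'k::real_normed_field"
  assumes "summable (\<lambda>n. (norm (x n))\<^sup>2)" "summable (\<lambda>n. (norm (y n))\<^sup>2)"
  shows "summable (\<lambda>n. (norm (x n - y n))\<^sup>2)"
  using summable_norm_add2[of x "\<lambda>n. - y n"] assms by simp

instantiation ell2 :: (real_normed_field) real_vector
begin

lift_definition zero_ell2 :: "'a ell2" is "\<lambda>_. 0" by simp
lift_definition plus_ell2 :: "'a ell2 \<Rightarrow> 'a ell2 \<Rightarrow> 'a ell2" is "\<lambda>x y n. x n + y n"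
  by (rule summable_norm_add2)
lift_definition minus_ell2 :: "'a ell2 \<Rightarrow> 'a ell2 \<Rightarrow> 'a ell2" is "\<lambda>x y n. x n - y n"
  by (rule summable_norm_diff2)
lift_definition uminus_ell2 :: "'a ell2 \<Rightarrow> 'a ell2" is "\<lambda>x n. - x n" by simp
lift_definition scaleR_ell2 :: "real \<Rightarrow> 'a ell2 \<Rightarrow> 'a ell2" is "\<lambda>r x n. r *\<^sub>R x n"
  by (simp add: power_mult_distrib summable_mult)

instance
  by standard (transfer; simp add: algebra_simps fun_eq_iff)+

end

lemmas ell2_nth_simps [simp] =
  zero_ell2.rep_eq plus_ell2.rep_eq minus_ell2.rep_eq uminus_ell2.rep_eq scaleR_ell2.rep_eq

lemma ell2_summable: "summable (\<lambda>n. (norm (ell2_nth x n))\<^sup>2)"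
  using ell2_nth[of x] by simp

instantiation ell2 :: (real_normed_field) real_normed_vector
begin

definition norm_ell2 :: "'a ell2 \<Rightarrow> real"
  where "norm x = sqrt (\<Sum>n. (norm (ell2_nth x n))\<^sup>2)"

definition sgn_ell2 :: "'a ell2 \<Rightarrow> 'a ell2"
  where "sgn_ell2 x = inverse (norm x) *\<^sub>R x"

definition dist_ell2 :: "'a ell2 \<Rightarrow> 'a ell2 \<Rightarrow> real"
  where "dist_ell2 x y = norm (x - y)"

definition uniformity_ell2 :: "('a ell2 \<times> 'a ell2) filter"
  where "uniformity_ell2 = (INF e\<in>{0<..}. principal {(x, y). dist x y < e})"

definition open_ell2 :: "'a ell2 set \<Rightarrow> bool"
  where "open_ell2 S = (\<forall>x\<in>S. \<forall>\<^sub>F (x', y) in uniformity. x' = x \<longrightarrow> y \<in> S)"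

lemma ell2_L2_set_le_norm: "L2_set (\<lambda>n. norm (ell2_nth x n)) {..<N} \<le> norm x"
  unfolding norm_ell2_def L2_set_def
  by (intro real_sqrt_le_mono sum_le_suminf[OF ell2_summable]) auto

lemma L2_set_tendsto_norm_ell2:
  "(\<lambda>N. L2_set (\<lambda>n. norm (ell2_nth x n)) {..<N}) \<longlonglongrightarrow> norm x"
  unfolding norm_ell2_def L2_set_def
  by (intro tendsto_real_sqrt summable_LIMSEQ ell2_summable)

instance
proof
  fix x y :: "'a ell2" and r :: real and S :: "'a ell2 set"
  show "dist x y = norm (x - y)" by (fact dist_ell2_def)
  show "sgn x = inverse (norm x) *\<^sub>R x" by (fact sgn_ell2_def)
  show "uniformity = (INF e\<in>{0<..}. principal {(x :: 'a ell2, y). dist x y < e})"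
    by (fact uniformity_ell2_def)
  show "open S = (\<forall>x\<in>S. \<forall>\<^sub>F (x', y) in uniformity. x' = x \<longrightarrow> y \<in> S)"
    by (fact open_ell2_def)
  show "norm x = 0 \<longleftrightarrow> x = 0"
    unfolding norm_ell2_def using suminf_eq_zero_iff[OF ell2_summable[of x]]
    by (auto intro: ell2_eqI)
  show "norm (r *\<^sub>R x) = \<bar>r\<bar> * norm x"
    unfolding norm_ell2_def
    by (simp add: power_mult_distrib suminf_mult[OF ell2_summable] real_sqrt_mult)
  show "norm (x + y) \<le> norm x + norm y"
  proof (rule LIMSEQ_le_const2[OF L2_set_tendsto_norm_ell2], intro exI allI impI)
    fix N :: nat
    have "L2_set (\<lambda>n. norm (ell2_nth (x + y) n)) {..<N}
        \<le> L2_set (\<lambda>n. norm (ell2_nth x n) + norm (ell2_nth y n)) {..<N}"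
      by (rule L2_set_mono) (auto simp: norm_triangle_ineq)
    also have "\<dots> \<le> L2_set (\<lambda>n. norm (ell2_nth x n)) {..<N} + L2_set (\<lambda>n. norm (ell2_nth y n)) {..<N}"
      by (rule L2_set_triangle_ineq)
    also have "\<dots> \<le> norm x + norm y" by (intro add_mono ell2_L2_set_le_norm)
    finally show "L2_set (\<lambda>n. norm (ell2_nth (x + y) n)) {..<N} \<le> norm x + norm y" .
  qed
qed

end

lemma ell2_nth_le_norm: "norm (ell2_nth x n) \<le> norm x"
  using member_le_L2_set[of "{..<Suc n}" n "\<lambda>n. norm (ell2_nth x n)"]
    ell2_L2_set_le_norm[of x "Suc n"] by simp

lemma Ell2_bounded:
  fixes a :: "nat \<Rightarrow> 'k::real_normed_field"
  assumes "\<And>N. L2_set (\<lambda>n. norm (a n)) {..<N} \<le> C"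
  shows "ell2_nth (Ell2 a) = a" "norm (Ell2 a) \<le> C"
proof -
  have b: "(\<Sum>n<N. (norm (a n))\<^sup>2) \<le> C\<^sup>2" for N
    using assms[of N] unfolding L2_set_def by (rule sqrt_le_D)
  have "summable (\<lambda>n. (norm (a n))\<^sup>2)"
    by (rule summableI_nonneg_bounded[of _ "C\<^sup>2"]) (use b in auto)
  then show *: "ell2_nth (Ell2 a) = a" by (simp add: Ell2_inverse)
  show "norm (Ell2 a) \<le> C"
    by (rule LIMSEQ_le_const2[OF L2_set_tendsto_norm_ell2]) (use assms in \<open>auto simp: *\<close>)
qed

instance ell2 :: ("{real_normed_field,banach}") banach
proof
  fix X :: "nat \<Rightarrow> 'a ell2"
  assume C: "Cauchy X"
  have "Cauchy (\<lambda>k. ell2_nth (X k) n)" for n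
  proof (rule metric_CauchyI)
    fix e :: real assume "0 < e"
    then obtain M where M: "\<forall>i\<ge>M. \<forall>j\<ge>M. dist (X i) (X j) < e"
      using C unfolding Cauchy_def by blast
    have "dist (ell2_nth (X i) n) (ell2_nth (X j) n) < e" if "i \<ge> M" "j \<ge> M" for i j
      using M that ell2_nth_le_norm[of "X i - X j" n]
      by (simp add: dist_norm) (meson le_less_trans)
    then show "\<exists>M. \<forall>m\<ge>M. \<forall>k\<ge>M. dist (ell2_nth (X m) n) (ell2_nth (X k) n) < e" by blast
  qed
  then have "\<forall>n. \<exists>l. (\<lambda>k. ell2_nth (X k) n) \<longlonglongrightarrow> l"
    using Cauchy_convergent convergent_def by blast
  then obtain a where a: "\<And>n. (\<lambda>k. ell2_nth (X k) n) \<longlonglongrightarrow> a n" by metis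
  have tail: "L2_set (\<lambda>n. norm (ell2_nth (X i) n - a n)) {..<N} \<le> e"
    if M: "\<forall>i\<ge>M. \<forall>j\<ge>M. dist (X i) (X j) < e" and "i \<ge> M" for i M N and e :: real
  proof (rule LIMSEQ_le_const2)
    show "(\<lambda>j. L2_set (\<lambda>n. norm (ell2_nth (X i) n - ell2_nth (X j) n)) {..<N})
        \<longlonglongrightarrow> L2_set (\<lambda>n. norm (ell2_nth (X i) n - a n)) {..<N}"
      unfolding L2_set_def by (intro tendsto_intros a)
    show "\<exists>M. \<forall>j\<ge>M. L2_set (\<lambda>n. norm (ell2_nth (X i) n - ell2_nth (X j) n)) {..<N} \<le> e"
    proof (intro exI allI impI)
      fix j assume "j \<ge> M"
      then have "norm (X i - X j) \<le> e" using M \<open>i \<ge> M\<close> by (force simp: dist_norm)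
      then show "L2_set (\<lambda>n. norm (ell2_nth (X i) n - ell2_nth (X j) n)) {..<N} \<le> e"
        using ell2_L2_set_le_norm[of "X i - X j" N] by simp
    qed
  qed
  obtain M1 where M1: "\<forall>i\<ge>M1. \<forall>j\<ge>M1. dist (X i) (X j) < 1"
    using C zero_less_one unfolding Cauchy_def by blast
  define L where "L = X M1 - Ell2 (\<lambda>n. ell2_nth (X M1) n - a n)"
  have L: "ell2_nth L = a"
    unfolding L_def using Ell2_bounded(1)[OF tail[OF M1 order_refl]] by (simp add: fun_eq_iff)
  have "X \<longlonglongrightarrow> L"
  proof (rule metric_LIMSEQ_I)
    fix e :: real assume "0 < e"
    then have "0 < e / 2" by simp
    then obtain M where M: "\<forall>i\<ge>M. \<forall>j\<ge>M. dist (X i) (X j) < e / 2"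
      using C unfolding Cauchy_def by blast
    have "dist (X i) L < e" if "i \<ge> M" for i
    proof -
      have "X i - L = Ell2 (\<lambda>n. ell2_nth (X i) n - a n)"
        by (rule ell2_eqI) (simp add: L Ell2_bounded(1)[OF tail[OF M that]])
      then have "norm (X i - L) \<le> e / 2" using Ell2_bounded(2)[OF tail[OF M that]] by simp
      then show ?thesis using \<open>0 < e\<close> by (simp add: dist_norm)
    qed
    then show "\<exists>M. \<forall>n\<ge>M. dist (X n) L < e" by blast
  qed
  then show "convergent X" unfolding convergent_def by blast
qed

lift_definition scale_ell2 :: "'k::real_normed_field \<Rightarrow> 'k ell2 \<Rightarrow> 'k ell2" is "\<lambda>c x n. c * x n"
  by (simp add: norm_mult power_mult_distrib summable_mult)

interpretation ell2: banach_space_over "scale_ell2 :: 'k::{real_normed_field,banach} \<Rightarrow> _"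
proof
  fix c d :: 'k and x y :: "'k ell2" and r :: real
  show "scale_ell2 c (x + y) = scale_ell2 c x + scale_ell2 c y"
    by transfer (simp add: algebra_simps)
  show "scale_ell2 (c + d) x = scale_ell2 c x + scale_ell2 d x"
    by transfer (simp add: algebra_simps)
  show "scale_ell2 c (scale_ell2 d x) = scale_ell2 (c * d) x"
    by transfer (simp add: algebra_simps)
  show "scale_ell2 1 x = x"
    by transfer simp
  show "norm (scale_ell2 c x) = norm c * norm x"
    by (simp add: norm_ell2_def scale_ell2.rep_eq norm_mult power_mult_distrib
        suminf_mult[OF ell2_summable] real_sqrt_mult)
  show "scale_ell2 (of_real r) x = r *\<^sub>R x"
    by transfer (simp add: scaleR_conv_of_real)
qed


section \<open>Absolutely summing multilinear maps\<close>

text \<open>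
  An \<open>m\<close>-tuple of vectors is the restriction of a sequence \<^typ>\<open>nat \<Rightarrow> 'e\<close> to the indices \<open>q < m\<close>;
  a map on \<open>E \<times> \<dots> \<times> E\<close> (\<open>m\<close> factors) is a map on sequences that ignores all other coordinates.
  Continuity refers to the product topology on \<^typ>\<open>nat \<Rightarrow> 'e\<close>, which for such maps is the same as
  continuity on the \<open>m\<close>-fold product.
\<close>

definition multilinear_maps ::
  "('k::{real_normed_field,banach} \<Rightarrow> 'e::banach \<Rightarrow> 'e) \<Rightarrow> ('k \<Rightarrow> 'f::banach \<Rightarrow> 'f) \<Rightarrow> nat
    \<Rightarrow> ((nat \<Rightarrow> 'e) \<Rightarrow> 'f) set"
  where "multilinear_maps scale_E scale_F m =
    {T. (\<forall>x y. (\<forall>q<m. x q = y q) \<longrightarrow> T x = T y) \<and>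
        (\<forall>q<m. \<forall>x. Vector_Spaces.linear scale_E scale_F (\<lambda>v. T (x(q := v)))) \<and>
        continuous_on UNIV T}"

definition dual_ball :: "('k::{real_normed_field,banach} \<Rightarrow> 'e::banach \<Rightarrow> 'e) \<Rightarrow> ('e \<Rightarrow> 'k) set"
  where "dual_ball scale_E =
    {\<phi>. Vector_Spaces.linear scale_E (*) \<phi> \<and> bounded_linear \<phi> \<and> onorm \<phi> \<le> 1}"

definition weak_norm1 ::
  "('k::{real_normed_field,banach} \<Rightarrow> 'e::banach \<Rightarrow> 'e) \<Rightarrow> nat \<Rightarrow> (nat \<Rightarrow> 'e) \<Rightarrow> real"
  where "weak_norm1 scale_E N x = (SUP \<phi>\<in>dual_ball scale_E. \<Sum>j<N. norm (\<phi> (x j)))"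

text \<open>In the following, \<open>x q j\<close> is the \<open>j\<close>-th member of the \<open>q\<close>-th family.\<close>

definition abs_summing_maps ::
  "real \<Rightarrow> ('k::{real_normed_field,banach} \<Rightarrow> 'e::banach \<Rightarrow> 'e) \<Rightarrow> ('k \<Rightarrow> 'f::banach \<Rightarrow> 'f) \<Rightarrow> nat
    \<Rightarrow> ((nat \<Rightarrow> 'e) \<Rightarrow> 'f) set"
  where "abs_summing_maps r scale_E scale_F m =
    {T \<in> multilinear_maps scale_E scale_F m.
      \<exists>C\<ge>0. \<forall>(N::nat) (x :: nat \<Rightarrow> nat \<Rightarrow> 'e).
        (\<Sum>j<N. norm (T (\<lambda>q. x q j)) powr r) powr (1 / r) \<le> C * (\<Prod>q<m. weak_norm1 scale_E N (x q))}"

text \<open>The infimum is taken in the extended reals, so that it is \<open>\<infinity>\<close> if no exponent qualifies.\<close>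

definition r_opt :: "nat \<Rightarrow> ('k::{real_normed_field,banach} \<Rightarrow> 'f::banach \<Rightarrow> 'f) \<Rightarrow> ereal"
  where "r_opt m scale_F =
    (INF r\<in>{r::real. r > 0 \<and>
        multilinear_maps (scale_ell1 :: 'k \<Rightarrow> 'k ell1 \<Rightarrow> 'k ell1) scale_F m =
        abs_summing_maps r scale_ell1 scale_F m}.
      ereal r)"


section \<open>Cotype\<close>

text \<open>
  The integral \<open>\<integral>\<^sub>0\<^sup>1 \<parallel>\<Sum>j<N. r\<^sub>j(t) x\<^sub>j\<parallel>\<^sup>2 dt\<close> over the Rademacher functions is written as the average
  over all choices of signs.
\<close>

definition rademacher_norm :: "nat \<Rightarrow> (nat \<Rightarrow> 'f::banach) \<Rightarrow> real"
  where "rademacher_norm N x =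
    sqrt ((\<Sum>\<epsilon>\<in>{..<N} \<rightarrow>\<^sub>E {-1, 1::real}. (norm (\<Sum>j<N. \<epsilon> j *\<^sub>R x j))\<^sup>2) / 2 ^ N)"

definition has_cotype :: "real \<Rightarrow> 'f::banach itself \<Rightarrow> bool"
  where "has_cotype q (_ :: 'f itself) \<longleftrightarrow>
    (\<exists>C\<ge>0. \<forall>(N::nat) (x :: nat \<Rightarrow> 'f).
      (\<Sum>j<N. norm (x j) powr q) powr (1 / q) \<le> C * rademacher_norm N x)"

end

theory Submission
  imports Defs
begin

text \<open>
  By Grothendieck's inequality, operators from \<open>\<ell>\<^sub>\<infinity>\<close> to \<open>\<ell>\<^sub>1\<close> and from \<open>\<ell>\<^sub>1\<close> to \<open>\<ell>\<^sub>2\<close> are 2-summing. The first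
  fact gives \<open>\<Sum> \<parallel>x\<^sub>j\<parallel>\<^sup>2 < \<infinity>\<close> for weakly summable families in \<open>\<ell>\<^sub>1\<close>, hence the exponent \<open>2 / m\<close> for every
  range by Hoelder's inequality. It also gives a factorization \<open>x\<^sub>j = \<lambda>\<^sub>j v\<^sub>j\<close> with \<open>\<lambda>\<close> in \<open>\<ell>\<^sub>2\<close> and weakly
  2-summable \<open>v\<close>; for a Hilbert range the values of \<open>T\<close> on the \<open>v\<close>'s are square summable by the second
  fact, and Hoelder's inequality gives \<open>1 / r = m / 2 + 1 / 2\<close>. Since only the infimum matters, a weak-type
  version suffices, for which \<open>\<lambda>\<close> may be taken constant on a large set of indices.

  For sharpness, the rows of an \<open>N \<times> N\<close> Walsh matrix have norm \<open>N\<close> and weak norm at most \<open>N\<^bsup>3/2\<^esup>\<close>. With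
  range \<open>\<ell>\<^sub>1\<close> they are inserted into all arguments of the tensor product map, whose values have the product
  of the norms as norm. With range \<open>\<ell>\<^sub>2\<close> the first argument runs through unit vectors and the unit vector
  with index \<open>j\<close> selects the pairing of the other arguments with the \<open>j\<close>-th row.
\<close>

section \<open>Rademacher sums\<close>

lemma sum_PiE_Suc:
  fixes f :: "(nat \<Rightarrow> 'b) \<Rightarrow> 'c::comm_monoid_add"
  shows "(\<Sum>\<alpha>\<in>{..<Suc n} \<rightarrow>\<^sub>E B. f \<alpha>) = (\<Sum>\<alpha>\<in>{..<n} \<rightarrow>\<^sub>E B. \<Sum>b\<in>B. f (\<alpha>(n := b)))"
proof -
  have "(\<Sum>\<alpha>\<in>{..<Suc n} \<rightarrow>\<^sub>E B. f \<alpha>) = (\<Sum>p\<in>B \<times> ({..<n} \<rightarrow>\<^sub>E B). f ((snd p)(n := fst p)))"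
    unfolding lessThan_Suc PiE_insert_eq
    by (subst sum.reindex) (auto simp: split_beta inj_combinator[where T = "\<lambda>_. B"] intro!: sum.cong)
  also have "\<dots> = (\<Sum>\<alpha>\<in>{..<n} \<rightarrow>\<^sub>E B. \<Sum>b\<in>B. f (\<alpha>(n := b)))"
    by (simp add: sum.cartesian_product' sum.swap[of _ B])
  finally show ?thesis .
qed

definition signs :: "nat \<Rightarrow> (nat \<Rightarrow> real) set"
  where "signs n = ({..<n} \<rightarrow>\<^sub>E {-1, 1})"

lemma finite_signs [simp]: "finite (signs n)"
  by (simp add: signs_def finite_PiE)

lemma card_signs: "card (signs n) = 2 ^ n"
  by (simp add: signs_def card_PiE numeral_2_eq_2)

lemma sum_signs_Suc:
  "(\<Sum>\<epsilon>\<in>signs (Suc n). f \<epsilon>) = (\<Sum>\<epsilon>\<in>signs n. f (\<epsilon>(n := 1)) + f (\<epsilon>(n := -1)))"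
  for f :: "(nat \<Rightarrow> real) \<Rightarrow> 'c::comm_monoid_add"
  unfolding signs_def sum_PiE_Suc by (rule sum.cong) (simp_all add: add.commute[of "f (_(n := 1))"])

lemma signed_sum_upd:
  fixes x :: "nat \<Rightarrow> 'a::real_vector"
  shows "(\<Sum>j<Suc n. (\<epsilon>(n := s)) j *\<^sub>R x j) = (\<Sum>j<n. \<epsilon> j *\<^sub>R x j) + s *\<^sub>R x n"
  by simp

text \<open>Adding the two values of the last sign cancels the mixed terms, so the signs act as an
  orthonormal system.\<close>

lemma sum_signs_inner:
  fixes x y :: "nat \<Rightarrow> 'a::real_inner"
  shows "(\<Sum>\<epsilon>\<in>signs n. (\<Sum>j<n. \<epsilon> j *\<^sub>R x j) \<bullet> (\<Sum>j<n. \<epsilon> j *\<^sub>R y j))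
    = 2 ^ n * (\<Sum>j<n. x j \<bullet> y j)"
proof (induction n)
  case (Suc n)
  have "(\<Sum>\<epsilon>\<in>signs (Suc n). (\<Sum>j<Suc n. \<epsilon> j *\<^sub>R x j) \<bullet> (\<Sum>j<Suc n. \<epsilon> j *\<^sub>R y j))
      = (\<Sum>\<epsilon>\<in>signs n. 2 * ((\<Sum>j<n. \<epsilon> j *\<^sub>R x j) \<bullet> (\<Sum>j<n. \<epsilon> j *\<^sub>R y j)) + 2 * (x n \<bullet> y n))"
    unfolding sum_signs_Suc signed_sum_upd by (intro sum.cong) (simp_all add: algebra_simps)
  also have "\<dots> = 2 ^ Suc n * (\<Sum>j<Suc n. x j \<bullet> y j)"
    by (simp add: sum.distrib card_signs Suc flip: sum_distrib_left) (simp add: algebra_simps)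
  finally show ?case .
qed (simp add: signs_def)

lemma sum_signs_norm_power2:
  fixes x :: "nat \<Rightarrow> 'a::real_inner"
  shows "(\<Sum>\<epsilon>\<in>signs n. (norm (\<Sum>j<n. \<epsilon> j *\<^sub>R x j))\<^sup>2) = 2 ^ n * (\<Sum>j<n. (norm (x j))\<^sup>2)"
  using sum_signs_inner[where x=x and y=x] by (simp add: power2_norm_eq_inner)

text \<open>In the expansion only \<open>8 * (u \<bullet> v)\<^sup>2\<close> is not determined by
  the norms; Cauchy-Schwarz bounds it, and 12 = 4 + 8.\<close>

lemma norm_add_diff_power4_le:
  fixes u v :: "'a::real_inner"
  shows "norm (u + v) ^ 4 + norm (u - v) ^ 4
    \<le> 2 * norm u ^ 4 + 12 * ((norm u)\<^sup>2 * (norm v)\<^sup>2) + 2 * norm v ^ 4"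
proof -
  have *: "norm z ^ 4 = (z \<bullet> z)\<^sup>2" for z :: 'a
    by (simp flip: power2_norm_eq_inner)
  have "(u \<bullet> v)\<^sup>2 \<le> (norm u)\<^sup>2 * (norm v)\<^sup>2"
    using Cauchy_Schwarz_ineq[of u v] by (simp add: power2_norm_eq_inner)
  moreover have "norm (u + v) ^ 4 + norm (u - v) ^ 4
      = 2 * norm u ^ 4 + 4 * ((norm u)\<^sup>2 * (norm v)\<^sup>2) + 2 * norm v ^ 4 + 8 * (u \<bullet> v)\<^sup>2"
    unfolding * power2_norm_eq_inner
    by (simp add: inner_commute power2_eq_square algebra_simps)
  ultimately show ?thesis by linarith
qed

text \<open>The induction step pairs the two values of the last sign. With old sum \<open>s\<close>
  and new term \<open>b\<close>, the mixed term \<open>12 * s * b\<close> is exactly the one in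
  \<open>2 * (3 * (s + b)\<^sup>2)\<close>, which is why the constant 3 works.\<close>

lemma sum_signs_norm_power4_le:
  fixes x :: "nat \<Rightarrow> 'a::real_inner"
  shows "(\<Sum>\<epsilon>\<in>signs n. norm (\<Sum>j<n. \<epsilon> j *\<^sub>R x j) ^ 4) \<le> 2 ^ n * (3 * (\<Sum>j<n. (norm (x j))\<^sup>2)\<^sup>2)"
proof (induction n)
  case (Suc n)
  let ?S = "\<lambda>\<epsilon>. \<Sum>j<n. \<epsilon> j *\<^sub>R x j" and ?s = "\<Sum>j<n. (norm (x j))\<^sup>2"
  have "(\<Sum>\<epsilon>\<in>signs (Suc n). norm (\<Sum>j<Suc n. \<epsilon> j *\<^sub>R x j) ^ 4)
      = (\<Sum>\<epsilon>\<in>signs n. norm (?S \<epsilon> + x n) ^ 4 + norm (?S \<epsilon> - x n) ^ 4)"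
    unfolding sum_signs_Suc signed_sum_upd by simp
  also have "\<dots> \<le> (\<Sum>\<epsilon>\<in>signs n. 2 * norm (?S \<epsilon>) ^ 4 + 12 * ((norm (?S \<epsilon>))\<^sup>2 * (norm (x n))\<^sup>2)
      + 2 * norm (x n) ^ 4)"
    by (intro sum_mono norm_add_diff_power4_le)
  also have "\<dots> = 2 * (\<Sum>\<epsilon>\<in>signs n. norm (?S \<epsilon>) ^ 4)
      + 12 * ((\<Sum>\<epsilon>\<in>signs n. (norm (?S \<epsilon>))\<^sup>2) * (norm (x n))\<^sup>2) + 2 ^ n * (2 * norm (x n) ^ 4)"
    by (simp add: sum.distrib sum_distrib_left sum_distrib_right card_signs)
  also have "\<dots> \<le> 2 * (2 ^ n * (3 * ?s\<^sup>2)) + 12 * (2 ^ n * ?s * (norm (x n))\<^sup>2)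
      + 2 ^ n * (2 * norm (x n) ^ 4)"
    using Suc by (simp add: sum_signs_norm_power2)
  also have "\<dots> \<le> 2 ^ Suc n * (3 * (?s + (norm (x n))\<^sup>2)\<^sup>2)"
    by (simp add: power2_eq_square algebra_simps power4_eq_xxxx)
  finally show ?case by simp
qed (simp add: signs_def)

text \<open>A pointwise polynomial inequality, averaged over the signs, bounds the first moment from
  below by the second and fourth moments. The fourth moment constant 3 leaves the factor 1 - 3 * 4 /
  27 = 5 / 9, and 9 / 5 \<le> 2.\<close>

lemma khinchine_L1:
  fixes x :: "nat \<Rightarrow> 'a::real_inner"
  shows "sqrt (\<Sum>j<n. (norm (x j))\<^sup>2) \<le> 2 * ((\<Sum>\<epsilon>\<in>signs n. norm (\<Sum>j<n. \<epsilon> j *\<^sub>R x j)) / 2 ^ n)"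
proof -
  define s where "s = sqrt (\<Sum>j<n. (norm (x j))\<^sup>2)"
  have s: "s \<ge> 0" "s\<^sup>2 = (\<Sum>j<n. (norm (x j))\<^sup>2)" by (auto simp: s_def sum_nonneg)
  let ?X = "\<lambda>\<epsilon>. norm (\<Sum>j<n. \<epsilon> j *\<^sub>R x j)"
  txt \<open>The constant \<open>4 / 27\<close> makes the two sides touch at \<open>t = 3 / 2 * s\<close>.\<close>
  have key: "s\<^sup>2 * t\<^sup>2 - 4 / 27 * t ^ 4 \<le> s ^ 3 * t" if "t \<ge> 0" for t
  proof -
    have "s ^ 3 * t - s\<^sup>2 * t\<^sup>2 + 4 / 27 * t ^ 4 = 4 / 27 * t * ((t - 3 / 2 * s)\<^sup>2 * (t + 3 * s))"
      by (simp add: power2_eq_square power3_eq_cube power4_eq_xxxx field_simps)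
    moreover have "\<dots> \<ge> 0" using that s(1) by simp
    ultimately show ?thesis by linarith
  qed
  have "s\<^sup>2 * (2 ^ n * s\<^sup>2) - 4 / 27 * (2 ^ n * (3 * (s\<^sup>2)\<^sup>2))
      \<le> s\<^sup>2 * (\<Sum>\<epsilon>\<in>signs n. (?X \<epsilon>)\<^sup>2) - 4 / 27 * (\<Sum>\<epsilon>\<in>signs n. ?X \<epsilon> ^ 4)"
    using sum_signs_norm_power4_le[where n=n and x=x] unfolding sum_signs_norm_power2 s(2) by simp
  also have "\<dots> = (\<Sum>\<epsilon>\<in>signs n. s\<^sup>2 * (?X \<epsilon>)\<^sup>2 - 4 / 27 * ?X \<epsilon> ^ 4)"
    by (simp add: sum_subtractf sum_distrib_left)
  also have "\<dots> \<le> (\<Sum>\<epsilon>\<in>signs n. s ^ 3 * ?X \<epsilon>)"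
    by (intro sum_mono key) simp
  also have "\<dots> = s ^ 3 * (\<Sum>\<epsilon>\<in>signs n. ?X \<epsilon>)" by (simp add: sum_distrib_left)
  finally have "s ^ 3 * (2 ^ n * s) * (5 / 9) \<le> s ^ 3 * (\<Sum>\<epsilon>\<in>signs n. ?X \<epsilon>)"
    by (simp add: power2_eq_square power3_eq_cube algebra_simps)
  then have "s ^ 3 * (2 ^ n * s * (5 / 9)) \<le> s ^ 3 * (\<Sum>\<epsilon>\<in>signs n. ?X \<epsilon>)" by (simp only: mult.assoc)
  then have "s = 0 \<or> 2 ^ n * s * (5 / 9) \<le> (\<Sum>\<epsilon>\<in>signs n. ?X \<epsilon>)"
    using s(1) by (subst (asm) mult_le_cancel_left) (auto simp: not_less)
  then have "2 ^ n * s \<le> 2 * (\<Sum>\<epsilon>\<in>signs n. ?X \<epsilon>)"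
  proof
    assume "2 ^ n * s * (5 / 9) \<le> (\<Sum>\<epsilon>\<in>signs n. ?X \<epsilon>)"
    moreover have "2 ^ n * s \<ge> 0" using s by simp
    ultimately show ?thesis by linarith
  qed (simp add: sum_nonneg)
  then show ?thesis unfolding s_def[symmetric] by (simp add: field_simps)
qed

section \<open>Grothendieck's inequality\<close>

text \<open>The form in Grothendieck's inequality, with products of scalars replaced by inner
  products. The coordinates may have any index type, so that sign patterns can serve as
  indices.\<close>

definition vec_form :: "'a set \<Rightarrow> 'b set \<Rightarrow> ('a \<Rightarrow> 'b \<Rightarrow> real) \<Rightarrow> 'i set
    \<Rightarrow> ('a \<Rightarrow> 'i \<Rightarrow> real) \<Rightarrow> ('b \<Rightarrow> 'i \<Rightarrow> real) \<Rightarrow> real"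
  where "vec_form A B a I F G = (\<Sum>i\<in>A. \<Sum>j\<in>B. a i j * (\<Sum>k\<in>I. F i k * G j k))"

lemma vec_form_scale: "vec_form A B a I (\<lambda>i k. \<alpha> * F i k) (\<lambda>j k. \<gamma> * G j k) = \<alpha> * \<gamma> * vec_form A B a I F G"
  by (simp add: vec_form_def sum_distrib_left mult_ac)

lemma vec_form_swap: "vec_form A B a I F G = (\<Sum>k\<in>I. \<Sum>i\<in>A. \<Sum>j\<in>B. a i j * (F i k * G j k))"
proof -
  have "(\<Sum>k\<in>I. \<Sum>i\<in>A. \<Sum>j\<in>B. a i j * (F i k * G j k))
      = (\<Sum>i\<in>A. \<Sum>k\<in>I. \<Sum>j\<in>B. a i j * (F i k * G j k))" by (rule sum.swap)
  also have "\<dots> = (\<Sum>i\<in>A. \<Sum>j\<in>B. \<Sum>k\<in>I. a i j * (F i k * G j k))"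
    by (intro sum.cong refl sum.swap)
  finally show ?thesis by (simp add: vec_form_def sum_distrib_left)
qed

text \<open>All dimensions share one bound, because the improvement step passes from dimension
  \<open>d\<close> to the \<open>2 ^ d\<close> sign patterns. A definition cannot quantify over the
  type of coordinate indices, hence naturals are used here and \<open>vec_form_boundD\<close>
  transfers the bound to any finite index set.\<close>

definition vec_form_bound :: "'a set \<Rightarrow> 'b set \<Rightarrow> ('a \<Rightarrow> 'b \<Rightarrow> real) \<Rightarrow> real \<Rightarrow> bool"
  where "vec_form_bound A B a \<beta> \<longleftrightarrow> (\<forall>(d::nat) F G.
    (\<forall>i\<in>A. (\<Sum>k<d. (F i k)\<^sup>2) \<le> 1) \<longrightarrow> (\<forall>j\<in>B. (\<Sum>k<d. (G j k)\<^sup>2) \<le> 1) \<longrightarrow>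
    vec_form A B a {..<d} F G \<le> \<beta>)"

lemma vec_form_boundD:
  fixes F :: "'a \<Rightarrow> 'i \<Rightarrow> real"
  assumes "vec_form_bound A B a \<beta>" "finite I" "\<alpha> > 0" "\<gamma> > 0"
    and F: "\<And>i. i \<in> A \<Longrightarrow> (\<Sum>k\<in>I. (F i k)\<^sup>2) \<le> \<alpha>\<^sup>2"
    and G: "\<And>j. j \<in> B \<Longrightarrow> (\<Sum>k\<in>I. (G j k)\<^sup>2) \<le> \<gamma>\<^sup>2"
  shows "vec_form A B a I F G \<le> \<alpha> * \<gamma> * \<beta>"
proof -
  obtain h where "bij_betw h {0..<card I} I"
    using ex_bij_betw_nat_finite[OF \<open>finite I\<close>] by blast
  then have h: "(\<Sum>k<card I. f (h k)) = (\<Sum>k\<in>I. f k)" for f :: "'i \<Rightarrow> real"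
    by (metis sum.reindex_bij_betw lessThan_atLeast0)
  let ?F = "\<lambda>i k. F i k / \<alpha>" and ?G = "\<lambda>j k. G j k / \<gamma>"
  have "vec_form A B a {..<card I} (\<lambda>i k. ?F i (h k)) (\<lambda>j k. ?G j (h k)) \<le> \<beta>"
  proof (rule assms(1)[unfolded vec_form_bound_def, rule_format])
    show "(\<Sum>k<card I. (F i (h k) / \<alpha>)\<^sup>2) \<le> 1" if "i \<in> A" for i
      using F[OF that] h[of "\<lambda>k. (F i k)\<^sup>2"] assms by (simp add: power_divide flip: sum_divide_distrib)
    show "(\<Sum>k<card I. (G j (h k) / \<gamma>)\<^sup>2) \<le> 1" if "j \<in> B" for j
      using G[OF that] h[of "\<lambda>k. (G j k)\<^sup>2"] assms by (simp add: power_divide flip: sum_divide_distrib)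
  qed
  also have "vec_form A B a {..<card I} (\<lambda>i k. ?F i (h k)) (\<lambda>j k. ?G j (h k))
      = vec_form A B a I ?F ?G"
    unfolding vec_form_def h[of "\<lambda>k. ?F _ k * ?G _ k"] ..
  finally have "\<alpha> * \<gamma> * vec_form A B a I ?F ?G \<le> \<alpha> * \<gamma> * \<beta>" using assms by simp
  then show ?thesis unfolding vec_form_scale[symmetric] using assms by simp
qed

context
  fixes A :: "'a set" and B :: "'b set" and a :: "'a \<Rightarrow> 'b \<Rightarrow> real" and W :: real
  assumes fin: "finite A" "finite B"
    and W: "\<And>s t. (\<And>i. \<bar>s i\<bar> \<le> 1) \<Longrightarrow> (\<And>j. \<bar>t j\<bar> \<le> 1)
      \<Longrightarrow> (\<Sum>i\<in>A. \<Sum>j\<in>B. a i j * (s i * t j)) \<le> W"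
begin

lemma sign_bound_nonneg: "W \<ge> 0"
  using W[of "\<lambda>_. 0" "\<lambda>_. 0"] by simp

lemma scalar_form_le:
  assumes "\<And>i. \<bar>s i\<bar> \<le> c" "\<And>j. \<bar>t j\<bar> \<le> c" "c > 0"
  shows "(\<Sum>i\<in>A. \<Sum>j\<in>B. a i j * (s i * t j)) \<le> c\<^sup>2 * W"
proof -
  have "(\<Sum>i\<in>A. \<Sum>j\<in>B. a i j * (s i / c * (t j / c))) \<le> W"
    by (rule W) (use assms in \<open>auto simp: field_simps\<close>)
  moreover have "(\<Sum>i\<in>A. \<Sum>j\<in>B. a i j * (s i * t j)) = c\<^sup>2 * (\<Sum>i\<in>A. \<Sum>j\<in>B. a i j * (s i / c * (t j / c)))"
    using assms by (simp add: sum_distrib_left power2_eq_square field_simps)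
  ultimately show ?thesis using assms by simp
qed

text \<open>Replace the vectors by Rademacher sums with the same inner products and truncate these at 8. The
  truncated parts are scalars bounded by 8 for every choice of signs; the remainders have
  \<open>L\<^sub>2\<close>-norm at most \<open>1 / 4\<close> by the fourth moment bound, and the old bound applies to them.\<close>

lemma vec_form_bound_improve:
  assumes "vec_form_bound A B a \<beta>"
  shows "vec_form_bound A B a (64 * W + \<beta> / 2)"
  unfolding vec_form_bound_def
proof (intro allI impI)
  fix d :: nat and F :: "'a \<Rightarrow> nat \<Rightarrow> real" and G :: "'b \<Rightarrow> nat \<Rightarrow> real"
  assume F: "\<forall>i\<in>A. (\<Sum>k<d. (F i k)\<^sup>2) \<le> 1" and G: "\<forall>j\<in>B. (\<Sum>k<d. (G j k)\<^sup>2) \<le> 1"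
  define X where "X = (\<lambda>i \<epsilon>. \<Sum>k<d. \<epsilon> k *\<^sub>R F i k)"
  define Y where "Y = (\<lambda>j \<epsilon>. \<Sum>k<d. \<epsilon> k *\<^sub>R G j k)"
  define c where "c = (\<lambda>x::real. max (- 8) (min 8 x))"
  define r where "r = (\<lambda>x. x - c x)"
  define p where "p = (2::real) ^ d"
  have p: "p > 0" by (simp add: p_def)
  have c2: "(c x)\<^sup>2 \<le> x\<^sup>2" and c8: "\<bar>c x\<bar> \<le> 8" for x
    by (auto simp: c_def abs_le_square_iff[symmetric])
  have r2: "(r x)\<^sup>2 \<le> x ^ 4 / 64" for x
  proof (cases "\<bar>x\<bar> \<le> 8")
    case False
    then have "\<bar>r x\<bar> \<le> \<bar>x\<bar>" by (auto simp: r_def c_def)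
    then have "(r x)\<^sup>2 \<le> x\<^sup>2" by (simp add: abs_le_square_iff)
    also have "8\<^sup>2 \<le> x\<^sup>2" using False by (subst abs_le_square_iff[symmetric]) simp
    then have "x\<^sup>2 * 64 \<le> x\<^sup>2 * x\<^sup>2" by (intro mult_left_mono) auto
    then have "x\<^sup>2 \<le> x ^ 4 / 64" by (simp add: power4_eq_xxxx power2_eq_square)
    finally show ?thesis .
  qed (auto simp: r_def c_def)
  have m2: "(\<Sum>\<epsilon>\<in>signs d. (\<Sum>k<d. \<epsilon> k *\<^sub>R H k)\<^sup>2) \<le> (sqrt p)\<^sup>2"
    and m4: "(\<Sum>\<epsilon>\<in>signs d. (r (\<Sum>k<d. \<epsilon> k *\<^sub>R H k))\<^sup>2) \<le> (sqrt p / 4)\<^sup>2"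
    and mc: "(\<Sum>\<epsilon>\<in>signs d. (c (\<Sum>k<d. \<epsilon> k *\<^sub>R H k))\<^sup>2) \<le> (sqrt p)\<^sup>2"
    if H: "(\<Sum>k<d. (H k)\<^sup>2) \<le> 1" for H :: "nat \<Rightarrow> real"
  proof -
    show *: "(\<Sum>\<epsilon>\<in>signs d. (\<Sum>k<d. \<epsilon> k *\<^sub>R H k)\<^sup>2) \<le> (sqrt p)\<^sup>2"
      using sum_signs_norm_power2[where n=d and x=H] H p by (simp add: p_def)
    show "(\<Sum>\<epsilon>\<in>signs d. (c (\<Sum>k<d. \<epsilon> k *\<^sub>R H k))\<^sup>2) \<le> (sqrt p)\<^sup>2"
      by (rule order_trans[OF sum_mono *]) (rule c2)
    have "(\<Sum>\<epsilon>\<in>signs d. (r (\<Sum>k<d. \<epsilon> k *\<^sub>R H k))\<^sup>2) \<le> (\<Sum>\<epsilon>\<in>signs d. (\<Sum>k<d. \<epsilon> k *\<^sub>R H k) ^ 4 / 64)"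
      by (intro sum_mono r2)
    also have "\<dots> \<le> p * (3 * (\<Sum>k<d. (H k)\<^sup>2)\<^sup>2) / 64"
      using sum_signs_norm_power4_le[where n=d and x=H] by (simp add: p_def flip: sum_divide_distrib)
    also have "\<dots> \<le> p * (3 * 1\<^sup>2) / 64"
      using H p by (intro divide_right_mono mult_left_mono power_mono) (auto simp: sum_nonneg)
    also have "\<dots> \<le> (sqrt p / 4)\<^sup>2" using p by (simp add: power_divide)
    finally show "(\<Sum>\<epsilon>\<in>signs d. (r (\<Sum>k<d. \<epsilon> k *\<^sub>R H k))\<^sup>2) \<le> (sqrt p / 4)\<^sup>2" .
  qed
  let ?V = "vec_form A B a (signs d)"
  have "p * vec_form A B a {..<d} F G = ?V X Y"
    using sum_signs_inner[where n=d and x="F _" and y="G _"]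
    by (simp add: vec_form_def X_def Y_def p_def sum_distrib_left mult.left_commute)
  also have "X = (\<lambda>i \<epsilon>. c (X i \<epsilon>) + r (X i \<epsilon>))" by (simp add: r_def)
  \<comment> \<open>One factor is split at a time, so each remainder term pairs a vector of length
    at most \<open>sqrt p / 4\<close> with one of length at most \<open>sqrt p\<close> and
    contributes \<beta> / 4 after division by \<open>p\<close>.\<close>
  also have "?V \<dots> Y = ?V (\<lambda>i \<epsilon>. c (X i \<epsilon>)) (\<lambda>j \<epsilon>. c (Y j \<epsilon>)) + ?V (\<lambda>i \<epsilon>. r (X i \<epsilon>)) Y
      + ?V (\<lambda>i \<epsilon>. c (X i \<epsilon>)) (\<lambda>j \<epsilon>. r (Y j \<epsilon>))"
    unfolding vec_form_def sum.distrib[symmetric] distrib_left[symmetric]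
    by (intro sum.cong refl arg_cong2[where f="(*)"]) (simp add: r_def algebra_simps)
  also have "\<dots> \<le> p * (8\<^sup>2 * W) + sqrt p / 4 * sqrt p * \<beta> + sqrt p * (sqrt p / 4) * \<beta>"
  proof (intro add_mono)
    have "?V (\<lambda>i \<epsilon>. c (X i \<epsilon>)) (\<lambda>j \<epsilon>. c (Y j \<epsilon>)) \<le> (\<Sum>\<epsilon>\<in>signs d. 8\<^sup>2 * W)"
      unfolding vec_form_swap by (intro sum_mono scalar_form_le c8) auto
    then show "?V (\<lambda>i \<epsilon>. c (X i \<epsilon>)) (\<lambda>j \<epsilon>. c (Y j \<epsilon>)) \<le> p * (8\<^sup>2 * W)"
      by (simp add: card_signs p_def)
    show "?V (\<lambda>i \<epsilon>. r (X i \<epsilon>)) Y \<le> sqrt p / 4 * sqrt p * \<beta>"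
      by (rule vec_form_boundD[OF assms]) (use p F G m2 m4 in \<open>simp_all add: X_def Y_def\<close>)
    show "?V (\<lambda>i \<epsilon>. c (X i \<epsilon>)) (\<lambda>j \<epsilon>. r (Y j \<epsilon>)) \<le> sqrt p * (sqrt p / 4) * \<beta>"
      by (rule vec_form_boundD[OF assms]) (use p F G mc m4 in \<open>simp_all add: X_def Y_def\<close>)
  qed
  also have "\<dots> = p * (64 * W + \<beta> / 2)" using p by (simp add: algebra_simps)
  finally show "vec_form A B a {..<d} F G \<le> 64 * W + \<beta> / 2" using p by simp
qed

lemma vec_form_bound_trivial: "vec_form_bound A B a (\<Sum>i\<in>A. \<Sum>j\<in>B. \<bar>a i j\<bar>)"
  unfolding vec_form_bound_def vec_form_def
proof (intro allI impI sum_mono)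
  fix d :: nat and F :: "'a \<Rightarrow> nat \<Rightarrow> real" and G :: "'b \<Rightarrow> nat \<Rightarrow> real" and i j
  assume "\<forall>i\<in>A. (\<Sum>k<d. (F i k)\<^sup>2) \<le> 1" "\<forall>j\<in>B. (\<Sum>k<d. (G j k)\<^sup>2) \<le> 1" "i \<in> A" "j \<in> B"
  then have F: "(\<Sum>k<d. (F i k)\<^sup>2) \<le> 1" and G: "(\<Sum>k<d. (G j k)\<^sup>2) \<le> 1" by auto
  have "\<bar>\<Sum>k<d. F i k * G j k\<bar> \<le> (\<Sum>k<d. \<bar>F i k\<bar> * \<bar>G j k\<bar>)"
    by (rule order_trans[OF sum_abs]) (simp add: abs_mult)
  also have "\<dots> \<le> L2_set (F i) {..<d} * L2_set (G j) {..<d}" by (rule L2_set_mult_ineq)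
  also have "\<dots> \<le> 1 * 1" using F G by (intro mult_mono) (auto simp: L2_set_def sum_nonneg)
  finally have "\<bar>a i j\<bar> * \<bar>\<Sum>k<d. F i k * G j k\<bar> \<le> \<bar>a i j\<bar> * 1" by (intro mult_left_mono) auto
  then show "a i j * (\<Sum>k<d. F i k * G j k) \<le> \<bar>a i j\<bar>" by (simp flip: abs_mult)
qed

text \<open>The infimum of all nonnegative bounds is itself a bound. Applying the improvement step
  to it gives \<beta> \<le> 64 * W + \<beta> / 2, and the last term is absorbed; the trivial
  estimate guarantees that the infimum is taken over a nonempty set.\<close>

lemma vec_form_bound_Grothendieck: "vec_form_bound A B a (128 * W)"
proof -
  define \<beta> where "\<beta> = Inf {\<beta>. \<beta> \<ge> 0 \<and> vec_form_bound A B a \<beta>}"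
  let ?S = "{\<beta>. \<beta> \<ge> 0 \<and> vec_form_bound A B a \<beta>}"
  have "(\<Sum>i\<in>A. \<Sum>j\<in>B. \<bar>a i j\<bar>) \<in> ?S" using vec_form_bound_trivial by (auto intro!: sum_nonneg)
  then have ne: "?S \<noteq> {}" by blast
  have bdd: "bdd_below ?S" by (auto intro!: bdd_belowI[of _ 0])
  have "\<beta> \<ge> 0" unfolding \<beta>_def by (rule cInf_greatest[OF ne]) auto
  have "vec_form_bound A B a \<beta>"
    unfolding vec_form_bound_def
  proof (intro allI impI)
    fix d :: nat and F :: "'a \<Rightarrow> nat \<Rightarrow> real" and G :: "'b \<Rightarrow> nat \<Rightarrow> real"
    assume "\<forall>i\<in>A. (\<Sum>k<d. (F i k)\<^sup>2) \<le> 1" "\<forall>j\<in>B. (\<Sum>k<d. (G j k)\<^sup>2) \<le> 1"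
    then show "vec_form A B a {..<d} F G \<le> \<beta>"
      unfolding \<beta>_def by (intro cInf_greatest[OF ne]) (simp add: vec_form_bound_def)
  qed
  then have "64 * W + \<beta> / 2 \<in> ?S" using vec_form_bound_improve sign_bound_nonneg \<open>\<beta> \<ge> 0\<close> by auto
  then have "\<beta> \<le> 64 * W + \<beta> / 2" unfolding \<beta>_def by (rule cInf_lower[OF _ bdd])
  then have "\<beta> \<le> 128 * W" by simp
  then show ?thesis using \<open>vec_form_bound A B a \<beta>\<close> unfolding vec_form_bound_def by force
qed

text \<open>\<open>vec_form_boundD\<close> divides by the radii, so it is applied with \<alpha> + x
  and \<gamma> + x for small positive \<open>x\<close>; this admits radius zero.\<close>

theorem Grothendieck_inequality:
  fixes F :: "'a \<Rightarrow> 'i \<Rightarrow> real"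
  assumes "finite I" "\<alpha> \<ge> 0" "\<gamma> \<ge> 0"
    and F: "\<And>i. i \<in> A \<Longrightarrow> (\<Sum>k\<in>I. (F i k)\<^sup>2) \<le> \<alpha>\<^sup>2"
    and G: "\<And>j. j \<in> B \<Longrightarrow> (\<Sum>k\<in>I. (G j k)\<^sup>2) \<le> \<gamma>\<^sup>2"
  shows "(\<Sum>i\<in>A. \<Sum>j\<in>B. a i j * (\<Sum>k\<in>I. F i k * G j k)) \<le> 128 * W * \<alpha> * \<gamma>"
proof (rule field_le_epsilon)
  fix e :: real assume "e > 0"
  have "((\<lambda>x. 128 * W * (\<alpha> + x) * (\<gamma> + x)) \<longlongrightarrow> 128 * W * (\<alpha> + 0) * (\<gamma> + 0)) (at_right 0)"
    by (intro tendsto_intros)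
  then have "eventually (\<lambda>x. 128 * W * (\<alpha> + x) * (\<gamma> + x) < 128 * W * \<alpha> * \<gamma> + e) (at_right 0)"
    by (rule order_tendstoD(2)) (use \<open>e > 0\<close> in simp)
  then have "eventually (\<lambda>x. x > 0 \<and> 128 * W * (\<alpha> + x) * (\<gamma> + x) < 128 * W * \<alpha> * \<gamma> + e) (at_right 0)"
    by (intro eventually_conj eventually_at_right_less)
  then obtain x where x: "x > 0" "128 * W * (\<alpha> + x) * (\<gamma> + x) < 128 * W * \<alpha> * \<gamma> + e"
    using eventually_happens'[OF trivial_limit_at_right_real] by blast
  have "\<alpha>\<^sup>2 \<le> (\<alpha> + x)\<^sup>2" "\<gamma>\<^sup>2 \<le> (\<gamma> + x)\<^sup>2" using x assms by (auto intro!: power_mono)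
  then have "vec_form A B a I F G \<le> (\<alpha> + x) * (\<gamma> + x) * (128 * W)"
    using x assms(1-3)
    by (intro vec_form_boundD[OF vec_form_bound_Grothendieck]) (auto intro: order_trans[OF F] order_trans[OF G])
  then show "(\<Sum>i\<in>A. \<Sum>j\<in>B. a i j * (\<Sum>k\<in>I. F i k * G j k)) \<le> 128 * W * \<alpha> * \<gamma> + e"
    using x unfolding vec_form_def by (simp add: algebra_simps)
qed

end

section \<open>Summing properties of \<open>\<ell>\<^sub>1\<close>\<close>

lemma ell1_nth_sum: "ell1_nth (\<Sum>i\<in>I. f i) n = (\<Sum>i\<in>I. ell1_nth (f i) n)"
  by (induction I rule: infinite_finite_induct) auto

lift_definition ell1_unit :: "nat \<Rightarrow> 'k::real_normed_field \<Rightarrow> 'k ell1" is "\<lambda>n a k. if k = n then a else 0"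
  by (rule summable_finite[where N = "{_}"]) auto

lemmas ell1_nth_unit [simp] = ell1_unit.rep_eq

lemma norm_ell1_unit [simp]: "norm (ell1_unit n a) = norm a"
  unfolding norm_ell1_def by (subst suminf_finite[of "{n}"]) auto

lemma ell1_unit_add: "ell1_unit n (a + b) = ell1_unit n a + ell1_unit n b"
  by (rule ell1_eqI) simp

lemma ell1_unit_scaleR: "ell1_unit n (r *\<^sub>R a) = r *\<^sub>R ell1_unit n a"
  by (rule ell1_eqI) simp

lemma linear_ell1_unit: "linear (ell1_unit n)"
  by (rule linearI) (simp_all add: ell1_unit_add ell1_unit_scaleR)

lemma norm_ell1_diff_initial:
  "norm (x - (\<Sum>n<M. ell1_unit n (ell1_nth x n))) = norm x - (\<Sum>n<M. norm (ell1_nth x n))"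
proof -
  have "norm (x - (\<Sum>n<M. ell1_unit n (ell1_nth x n)))
      = (\<Sum>k. norm (ell1_nth x k) - (if k < M then norm (ell1_nth x k) else 0))"
    unfolding norm_ell1_def by (rule arg_cong[where f=suminf]) (auto simp: ell1_nth_sum)
  also have "\<dots> = norm x - (\<Sum>k. if k < M then norm (ell1_nth x k) else 0)"
    unfolding norm_ell1_def
    by (rule suminf_diff[symmetric, OF ell1_summable summable_finite[of "{..<M}"]]) auto
  also have "(\<Sum>k. if k < M then norm (ell1_nth x k) else 0) = (\<Sum>n<M. norm (ell1_nth x n))"
    by (subst suminf_finite[of "{..<M}"]) auto
  finally show ?thesis .
qed

lemma ell1_norm_LIMSEQ: "(\<lambda>M. \<Sum>n<M. norm (ell1_nth x n)) \<longlonglongrightarrow> norm x"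
  unfolding norm_ell1_def by (rule summable_LIMSEQ[OF ell1_summable])

lemma ell1_initial_LIMSEQ: "(\<lambda>M. \<Sum>n<M. ell1_unit n (ell1_nth x n)) \<longlonglongrightarrow> x"
proof -
  have "(\<lambda>M. norm x - (\<Sum>n<M. norm (ell1_nth x n))) \<longlonglongrightarrow> norm x - norm x"
    by (intro tendsto_intros ell1_norm_LIMSEQ)
  then have "(\<lambda>M. norm ((\<Sum>n<M. ell1_unit n (ell1_nth x n)) - x)) \<longlonglongrightarrow> 0"
    by (simp add: norm_ell1_diff_initial norm_minus_commute)
  then show ?thesis by (simp add: tendsto_norm_zero_iff LIM_zero_iff)
qed

text \<open>Real coordinates: an index is a position together with a basis vector of the scalar field.\<close>

abbreviation idx :: "nat \<Rightarrow> (nat \<times> 'k::euclidean_space) set"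
  where "idx M \<equiv> {..<M} \<times> Basis"

definition crd :: "nat \<times> 'k \<Rightarrow> 'k::{real_normed_field,euclidean_space} ell1 \<Rightarrow> real"
  where "crd p x = ell1_nth x (fst p) \<bullet> snd p"

lemma crd_sum: "crd p (\<Sum>j\<in>A. s j *\<^sub>R x j) = (\<Sum>j\<in>A. s j * crd p (x j))"
  by (simp add: crd_def ell1_nth_sum inner_sum_left)

lemma sum_abs_crd_le: "(\<Sum>p\<in>idx M. \<bar>crd p x\<bar>) \<le> real DIM('k) * norm x"
  for x :: "'k::{real_normed_field,euclidean_space} ell1"
proof -
  have "(\<Sum>p\<in>idx M. \<bar>crd p x\<bar>) = (\<Sum>n<M. \<Sum>b\<in>Basis. \<bar>ell1_nth x n \<bullet> b\<bar>)"
    by (simp add: sum.cartesian_product' crd_def)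
  also have "\<dots> \<le> (\<Sum>n<M. \<Sum>b\<in>(Basis::'k set). norm (ell1_nth x n))"
    by (intro sum_mono Basis_le_norm)
  also have "\<dots> = real DIM('k) * (\<Sum>n<M. norm (ell1_nth x n))" by (simp add: sum_distrib_left)
  also have "\<dots> \<le> real DIM('k) * norm x" by (intro mult_left_mono ell1_sum_le_norm) simp
  finally show ?thesis .
qed

lemma signed_sum_crd_le:
  fixes x :: "'k::{real_normed_field,euclidean_space} ell1"
  assumes "\<And>p. \<bar>t p\<bar> \<le> 1"
  shows "(\<Sum>p\<in>idx M. t p * crd p x) \<le> real DIM('k) * norm x"
proof (rule order_trans[OF sum_mono sum_abs_crd_le])
  fix p
  have "t p * crd p x \<le> \<bar>t p\<bar> * \<bar>crd p x\<bar>" by (metis abs_ge_self abs_mult)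
  also have "\<dots> \<le> 1 * \<bar>crd p x\<bar>" by (intro mult_right_mono assms) simp
  finally show "t p * crd p x \<le> \<bar>crd p x\<bar>" by simp
qed

lemma sum_norm_le_sum_abs_crd: "(\<Sum>n<M. norm (ell1_nth x n)) \<le> (\<Sum>p\<in>idx M. \<bar>crd p x\<bar>)"
  by (simp add: sum.cartesian_product' crd_def sum_mono norm_le_l1)

lemma crd_expansion:
  "(\<Sum>p\<in>idx M. crd p x *\<^sub>R ell1_unit (fst p) (snd p)) = (\<Sum>n<M. ell1_unit n (ell1_nth x n))"
proof -
  have "(\<Sum>b\<in>Basis. (a \<bullet> b) *\<^sub>R ell1_unit n b) = ell1_unit n a" for n and a :: 'a
    using linear_sum[OF linear_ell1_unit, of n "\<lambda>b. (a \<bullet> b) *\<^sub>R b" Basis]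
    by (simp add: euclidean_representation ell1_unit_scaleR)
  then show ?thesis by (simp add: sum.cartesian_product' crd_def)
qed

text \<open>Grothendieck: operators from \<open>\<ell>\<^sub>\<infinity>\<close> to \<open>\<ell>\<^sub>1\<close> are 2-summing.\<close>

lemma ell1_two_summing:
  fixes x :: "'a \<Rightarrow> 'k::{real_normed_field,euclidean_space} ell1" and f :: "'c \<Rightarrow> 'a \<Rightarrow> real" and W :: real
  assumes fin: "finite A" "finite K"
    and W: "\<And>s. (\<And>j. \<bar>s j\<bar> \<le> 1) \<Longrightarrow> norm (\<Sum>j\<in>A. s j *\<^sub>R x j) \<le> W"
    and f: "\<And>j. j \<in> A \<Longrightarrow> (\<Sum>k\<in>K. (f k j)\<^sup>2) \<le> 1"
  shows "(\<Sum>k\<in>K. (norm (\<Sum>j\<in>A. f k j *\<^sub>R x j))\<^sup>2) \<le> (128 * real DIM('k) * W)\<^sup>2"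
proof -
  define u where "u k = (\<Sum>j\<in>A. f k j *\<^sub>R x j)" for k
  have W0: "W \<ge> 0" using W[of "\<lambda>_. 0"] by simp
  have "(\<Sum>k\<in>K. (\<Sum>n<M. norm (ell1_nth (u k) n))\<^sup>2) \<le> (128 * real DIM('k) * W)\<^sup>2" for M
  proof -
    define n where "n k = (\<Sum>p\<in>idx M. \<bar>crd p (u k)\<bar>)" for k
    define \<sigma> where "\<sigma> = sqrt (\<Sum>k\<in>K. (n k)\<^sup>2)"
    have \<sigma>: "\<sigma> \<ge> 0" "\<sigma>\<^sup>2 = (\<Sum>k\<in>K. (n k)\<^sup>2)" by (auto simp: \<sigma>_def sum_nonneg)
    \<comment> \<open>One factor of each square is linearized by signs. The sum becomes the form
      with matrix \<open>crd p (x j)\<close> on vectors indexed by \<open>K\<close> of lengths at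
      most 1 and \<sigma>, so Grothendieck's inequality bounds the square of \<sigma> by a multiple
      of \<sigma>.\<close>
    have "(\<Sum>k\<in>K. (n k)\<^sup>2) = (\<Sum>k\<in>K. \<Sum>p\<in>idx M. n k * sgn (crd p (u k)) * crd p (u k))"
      by (simp add: n_def power2_eq_square sum_distrib_left abs_sgn mult_ac)
    also have "\<dots> = (\<Sum>k\<in>K. \<Sum>p\<in>idx M. \<Sum>j\<in>A. crd p (x j) * (f k j * (n k * sgn (crd p (u k)))))"
    proof (intro sum.cong refl)
      fix k p
      show "n k * sgn (crd p (u k)) * crd p (u k)
          = (\<Sum>j\<in>A. crd p (x j) * (f k j * (n k * sgn (crd p (u k)))))"
        unfolding sum_distrib_right[symmetric] mult.assoc[symmetric]
        by (subst (2) u_def) (simp add: crd_sum sum_distrib_left mult_ac)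
    qed
    also have "\<dots> = (\<Sum>j\<in>A. \<Sum>p\<in>idx M. \<Sum>k\<in>K. crd p (x j) * (f k j * (n k * sgn (crd p (u k)))))"
      by (subst sum.swap, subst (2) sum.swap, subst sum.swap) (rule refl)
    also have "\<dots> = (\<Sum>j\<in>A. \<Sum>p\<in>idx M. crd p (x j) * (\<Sum>k\<in>K. f k j * (n k * sgn (crd p (u k)))))"
      by (simp add: sum_distrib_left)
    also have "\<dots> \<le> 128 * (real DIM('k) * W) * 1 * \<sigma>"
    proof (rule Grothendieck_inequality)
      show "(\<Sum>j\<in>A. \<Sum>p\<in>idx M. crd p (x j) * (s j * t p)) \<le> real DIM('k) * W"
        if "\<And>j. \<bar>s j\<bar> \<le> 1" "\<And>p. \<bar>t p\<bar> \<le> 1" for s t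
      proof -
        have "(\<Sum>j\<in>A. \<Sum>p\<in>idx M. crd p (x j) * (s j * t p))
            = (\<Sum>p\<in>idx M. t p * crd p (\<Sum>j\<in>A. s j *\<^sub>R x j))"
          by (subst sum.swap) (simp add: crd_sum sum_distrib_left mult_ac)
        also have "\<dots> \<le> real DIM('k) * norm (\<Sum>j\<in>A. s j *\<^sub>R x j)" by (rule signed_sum_crd_le[OF that(2)])
        also have "\<dots> \<le> real DIM('k) * W" by (intro mult_left_mono W that) simp
        finally show ?thesis .
      qed
      show "(\<Sum>k\<in>K. (n k * sgn (crd p (u k)))\<^sup>2) \<le> \<sigma>\<^sup>2" for p
        unfolding \<sigma>(2)
        by (intro sum_mono) (auto simp: power_mult_distrib sgn_if)
    qed (use fin f \<sigma> in auto)
    finally have "\<sigma> * \<sigma> \<le> 128 * real DIM('k) * W * \<sigma>"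
      unfolding \<sigma>(2)[symmetric] by (simp add: power2_eq_square mult_ac)
    then have "\<sigma> \<le> 128 * real DIM('k) * W"
      using \<sigma>(1) W0 by (cases "\<sigma> = 0") (auto simp: mult_le_cancel_right)
    then have "\<sigma>\<^sup>2 \<le> (128 * real DIM('k) * W)\<^sup>2" using \<sigma>(1) by (intro power_mono) auto
    moreover have "(\<Sum>k\<in>K. (\<Sum>n<M. norm (ell1_nth (u k) n))\<^sup>2) \<le> \<sigma>\<^sup>2"
      unfolding \<sigma>(2) n_def
      by (intro sum_mono power_mono sum_norm_le_sum_abs_crd sum_nonneg) simp
    ultimately show ?thesis by linarith
  qed
  moreover have "(\<lambda>M. \<Sum>k\<in>K. (\<Sum>n<M. norm (ell1_nth (u k) n))\<^sup>2) \<longlonglongrightarrow> (\<Sum>k\<in>K. (norm (u k))\<^sup>2)"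
    by (intro tendsto_intros ell1_norm_LIMSEQ)
  ultimately show ?thesis unfolding u_def[symmetric] by (intro LIMSEQ_le_const2) blast+
qed

text \<open>The coordinate vectors indexed by \<open>A\<close> are an admissible test family in
  \<open>ell1_two_summing\<close>, and they pick out the single vectors \<open>x k\<close>.\<close>

corollary ell1_Orlicz:
  fixes x :: "'a \<Rightarrow> 'k::{real_normed_field,euclidean_space} ell1" and W :: real
  assumes "finite A" "\<And>s. (\<And>j. \<bar>s j\<bar> \<le> 1) \<Longrightarrow> norm (\<Sum>j\<in>A. s j *\<^sub>R x j) \<le> W"
  shows "(\<Sum>j\<in>A. (norm (x j))\<^sup>2) \<le> (128 * real DIM('k) * W)\<^sup>2"
proof -
  have *: "(\<Sum>j\<in>A. (if j = k then 1 else 0) *\<^sub>R x j) = x k" if "k \<in> A" for k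
    using that assms(1) by (simp add: if_distrib[of "\<lambda>c. c *\<^sub>R _"] cong: if_cong)
  have "(\<Sum>k\<in>A. (norm (\<Sum>j\<in>A. (if j = k then 1 else 0) *\<^sub>R x j))\<^sup>2) \<le> (128 * real DIM('k) * W)\<^sup>2"
    using assms by (intro ell1_two_summing) (auto simp: if_distrib[of "\<lambda>c. c\<^sup>2"] cong: if_cong)
  then show ?thesis by (simp add: * cong: sum.cong)
qed

text \<open>A substitute for Pietsch factorization: violations of the domination on the not yet saturated
  indices are added to the test family until some index is saturated, and 2-summability bounds the
  number of saturated indices.\<close>

lemma ell1_dominated_subset:
  fixes x :: "'a \<Rightarrow> 'k::{real_normed_field,euclidean_space} ell1" and W \<theta> :: real
  assumes A: "finite A" and W: "\<And>s. (\<And>j. \<bar>s j\<bar> \<le> 1) \<Longrightarrow> norm (\<Sum>j\<in>A. s j *\<^sub>R x j) \<le> W"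
    and "\<theta> > 0"
  obtains J where "J \<subseteq> A" "\<theta> * card (A - J) \<le> (128 * real DIM('k) * W)\<^sup>2"
    "\<And>t. (norm (\<Sum>j\<in>J. t j *\<^sub>R x j))\<^sup>2 \<le> \<theta> * (\<Sum>j\<in>J. (t j)\<^sup>2)"
proof -
  \<comment> \<open>A test family of \<open>n\<close> rows: its columns have square sum at most 1,
    with equality on \<open>S\<close>, and the images of the rows have total square norm at least
    \<theta> times the total mass of the rows.\<close>
  define saturates where "saturates S n f \<longleftrightarrow> (\<forall>j\<in>A. (\<Sum>k<n. (f k j)\<^sup>2) \<le> 1) \<and> (\<forall>j\<in>S. (\<Sum>k<n. (f k j)\<^sup>2) = 1)
      \<and> \<theta> * (\<Sum>k<n. \<Sum>j\<in>A. (f k j)\<^sup>2) \<le> (\<Sum>k<n. (norm (\<Sum>j\<in>A. f k j *\<^sub>R x j))\<^sup>2)"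
    for S and n :: nat and f :: "nat \<Rightarrow> 'a \<Rightarrow> real"
  define P where "P = {S. S \<subseteq> A \<and> (\<exists>n f. saturates S n f)}"
  have "finite P" by (rule finite_subset[of _ "Pow A"]) (use A in \<open>auto simp: P_def\<close>)
  moreover have "{} \<in> P" by (auto simp: P_def saturates_def intro!: exI[of _ 0])
  then have "P \<noteq> {}" by blast
  ultimately obtain S where "S \<in> P" and max: "\<And>S'. S' \<in> P \<Longrightarrow> S \<subseteq> S' \<Longrightarrow> S = S'"
    using finite_has_maximal[of P] by metis
  then obtain n f where S: "S \<subseteq> A" and f: "saturates S n f"
    by (auto simp: P_def)
  have "finite S" using A S finite_subset by blast
  define J where "J = A - S"
  have J: "J \<subseteq> A" "finite J" "A - J = S" using S A by (auto simp: J_def)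
  have "real (card S) = (\<Sum>j\<in>S. \<Sum>k<n. (f k j)\<^sup>2)" using f by (simp add: saturates_def)
  also have "\<dots> \<le> (\<Sum>j\<in>A. \<Sum>k<n. (f k j)\<^sup>2)" by (rule sum_mono2[OF A S]) (auto simp: sum_nonneg)
  also have "\<dots> = (\<Sum>k<n. \<Sum>j\<in>A. (f k j)\<^sup>2)" by (rule sum.swap)
  finally have "\<theta> * card S \<le> \<theta> * (\<Sum>k<n. \<Sum>j\<in>A. (f k j)\<^sup>2)" using \<open>\<theta> > 0\<close> by simp
  also have "\<dots> \<le> (\<Sum>k<n. (norm (\<Sum>j\<in>A. f k j *\<^sub>R x j))\<^sup>2)" using f by (simp add: saturates_def)
  also have "\<dots> \<le> (128 * real DIM('k) * W)\<^sup>2"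
    by (rule ell1_two_summing) (use A W f in \<open>auto simp: saturates_def\<close>)
  finally have card: "\<theta> * card (A - J) \<le> (128 * real DIM('k) * W)\<^sup>2" by (simp add: J)
  have "(norm (\<Sum>j\<in>J. t j *\<^sub>R x j))\<^sup>2 \<le> \<theta> * (\<Sum>j\<in>J. (t j)\<^sup>2)" for t
  proof (rule ccontr)
    assume viol: "\<not> ?thesis"
    define \<rho> where "\<rho> j = 1 - (\<Sum>k<n. (f k j)\<^sup>2)" for j
    have \<rho>: "\<rho> j > 0" if "j \<in> J" for j
    proof (rule ccontr)
      assume "\<not> \<rho> j > 0"
      then have "\<rho> j = 0" using f that J(1) by (force simp: saturates_def \<rho>_def)
      then have "saturates (insert j S) n f" using f by (auto simp: saturates_def \<rho>_def)
      then have "insert j S \<in> P" using that J(1) S by (auto simp: P_def)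
      then have "S = insert j S" by (rule max) auto
      then show False using that J_def by auto
    qed
    define J' where "J' = {j \<in> J. t j \<noteq> 0}"
    have "J' \<noteq> {}"
    proof
      assume "J' = {}"
      then have "t j = 0" if "j \<in> J" for j using that by (auto simp: J'_def)
      then show False using viol by simp
    qed
    moreover have "finite J'" using J by (simp add: J'_def)
    \<comment> \<open>Minimality of the ratio of slack to \<open>(t j)\<^sup>2\<close> makes
      \<open>sqrt \<mu>\<close> the largest factor by which \<open>t\<close> can be scaled and added
      as a new row while all column sums stay at most 1; the column of \<open>j0\<close> then
      becomes saturated.\<close>
    ultimately obtain j0 where j0: "j0 \<in> J'" "\<And>j. j \<in> J' \<Longrightarrow> \<rho> j0 / (t j0)\<^sup>2 \<le> \<rho> j / (t j)\<^sup>2"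
      using ex_min_if_finite[of "(\<lambda>j. \<rho> j / (t j)\<^sup>2) ` J'"] by (force simp: not_less)
    define \<mu> where "\<mu> = \<rho> j0 / (t j0)\<^sup>2"
    have \<mu>: "\<mu> > 0" using \<rho> j0 by (simp add: \<mu>_def J'_def)
    define g where "g j = (if j \<in> J then sqrt \<mu> * t j else 0)" for j
    have g2: "(g j)\<^sup>2 = (if j \<in> J then \<mu> * (t j)\<^sup>2 else 0)" for j
      using \<mu> by (simp add: g_def power_mult_distrib)
    have g_le: "(g j)\<^sup>2 \<le> \<rho> j" if "j \<in> A" for j
    proof (cases "j \<in> J'")
      case True
      then have "\<mu> \<le> \<rho> j / (t j)\<^sup>2" using j0 by (simp add: \<mu>_def)
      then show ?thesis using True by (simp add: g2 J'_def field_simps)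
    next
      case False
      then have "g j = 0" by (auto simp: g_def J'_def)
      then show ?thesis using f that by (simp add: saturates_def \<rho>_def)
    qed
    have g_eq: "(g j0)\<^sup>2 = \<rho> j0" using j0 by (simp add: g2 \<mu>_def J'_def)
    have sum_g: "(\<Sum>j\<in>A. (g j)\<^sup>2) = \<mu> * (\<Sum>j\<in>J. (t j)\<^sup>2)"
      using J A by (simp add: g2 sum.If_cases Int_absorb1 sum_distrib_left)
    have "(\<Sum>j\<in>A. g j *\<^sub>R x j) = (\<Sum>j\<in>A. if j \<in> J then sqrt \<mu> *\<^sub>R t j *\<^sub>R x j else 0)"
      by (intro sum.cong) (auto simp: g_def)
    also have "\<dots> = sqrt \<mu> *\<^sub>R (\<Sum>j\<in>J. t j *\<^sub>R x j)"
      using J A by (simp add: sum.If_cases Int_absorb1 scaleR_sum_right)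
    finally have "(norm (\<Sum>j\<in>A. g j *\<^sub>R x j))\<^sup>2 = \<mu> * (norm (\<Sum>j\<in>J. t j *\<^sub>R x j))\<^sup>2"
      using \<mu> by (simp add: power_mult_distrib)
    also have "\<dots> \<ge> \<mu> * (\<theta> * (\<Sum>j\<in>J. (t j)\<^sup>2))" using viol \<mu> by simp
    finally have g_viol: "\<theta> * (\<Sum>j\<in>A. (g j)\<^sup>2) \<le> (norm (\<Sum>j\<in>A. g j *\<^sub>R x j))\<^sup>2"
      unfolding sum_g by (simp add: mult_ac)
    have g_S: "g j = 0" if "j \<in> S" for j using that by (simp add: g_def J_def)
    define f' where "f' = f(n := g)"
    have f': "(\<Sum>k<Suc n. h (f' k)) = (\<Sum>k<n. h (f k)) + h g" for h :: "('a \<Rightarrow> real) \<Rightarrow> real"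
      by (simp add: f'_def)
    have "saturates (insert j0 S) (Suc n) f'"
      unfolding saturates_def f'[of "\<lambda>k. (k _)\<^sup>2"] f'[of "\<lambda>k. \<Sum>j\<in>A. (k j)\<^sup>2"]
        f'[of "\<lambda>k. (norm (\<Sum>j\<in>A. k j *\<^sub>R x j))\<^sup>2"]
      using f g_le g_eq g_viol g_S by (auto simp: saturates_def \<rho>_def algebra_simps)
    moreover have "j0 \<in> J" using j0 by (simp add: J'_def)
    ultimately have "insert j0 S \<in> P" using J(1) S by (auto simp: P_def)
    then have "S = insert j0 S" by (rule max) auto
    then show False using \<open>j0 \<in> J\<close> J_def by auto
  qed
  with J(1) card show thesis by (rule that)
qed

text \<open>Grothendieck: operators from \<open>\<ell>\<^sub>1\<close> to a Hilbert space are 2-summing. The Hilbert space is given by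
  finitely many real coordinates \<open>\<phi> i\<close>.\<close>

lemma ell1_hilbert_two_summing:
  fixes v :: "'a \<Rightarrow> 'k::{real_normed_field,euclidean_space} ell1" and \<phi> :: "'i \<Rightarrow> 'k ell1 \<Rightarrow> real" and \<Gamma> \<theta> :: real
  assumes fin: "finite J" "finite I" and lin: "\<And>i. i \<in> I \<Longrightarrow> linear (\<phi> i)"
    and \<phi>: "\<And>x. (\<Sum>i\<in>I. (\<phi> i x)\<^sup>2) \<le> \<Gamma> * (norm x)\<^sup>2" and "\<Gamma> \<ge> 0"
    and v: "\<And>t. (norm (\<Sum>j\<in>J. t j *\<^sub>R v j))\<^sup>2 \<le> \<theta> * (\<Sum>j\<in>J. (t j)\<^sup>2)" and "\<theta> \<ge> 0"
  shows "(\<Sum>i\<in>I. \<Sum>j\<in>J. (\<phi> i (v j))\<^sup>2) \<le> 128 * (real DIM('k))\<^sup>2 * \<theta> * \<Gamma>"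
proof -
  let ?D = "real DIM('k)" and ?e = "\<lambda>p. ell1_unit (fst p) (snd p :: 'k)"
  \<comment> \<open>The functional with coefficients \<open>s\<close> is tested on the combination
    of the \<open>v j\<close> weighted by its own values; this bounds the square of
    \<open>?Z\<close> by a multiple of \<open>?Z\<close>.\<close>
  have sq: "(\<Sum>j\<in>J. (\<Sum>p\<in>idx M. s p * crd p (v j))\<^sup>2) \<le> ?D\<^sup>2 * \<theta>" (is "?Z \<le> _")
    if s: "\<And>p. \<bar>s p\<bar> \<le> 1" for s M
  proof -
    define \<tau> where "\<tau> j = (\<Sum>p\<in>idx M. s p * crd p (v j))" for j
    define Z where "Z = (\<Sum>j\<in>J. (\<tau> j)\<^sup>2)"
    have "Z \<ge> 0" by (simp add: Z_def sum_nonneg)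
    have "Z = (\<Sum>p\<in>idx M. s p * crd p (\<Sum>j\<in>J. \<tau> j *\<^sub>R v j))"
      unfolding Z_def power2_eq_square
      by (subst (2) \<tau>_def) (simp add: crd_sum sum_distrib_left sum.swap[of _ J] mult_ac)
    also have "\<dots> \<le> ?D * norm (\<Sum>j\<in>J. \<tau> j *\<^sub>R v j)" by (rule signed_sum_crd_le[OF s])
    finally have "Z\<^sup>2 \<le> (?D * norm (\<Sum>j\<in>J. \<tau> j *\<^sub>R v j))\<^sup>2" using \<open>Z \<ge> 0\<close> by (rule power_mono)
    also have "\<dots> \<le> ?D\<^sup>2 * (\<theta> * Z)"
      unfolding power_mult_distrib Z_def by (intro mult_left_mono v) simp
    finally have "Z * Z \<le> ?D\<^sup>2 * \<theta> * Z" by (simp add: power2_eq_square mult_ac)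
    then have "Z \<le> ?D\<^sup>2 * \<theta>"
      using \<open>Z \<ge> 0\<close> \<open>\<theta> \<ge> 0\<close> by (cases "Z = 0") (auto simp: mult_le_cancel_right)
    then show ?thesis by (simp add: Z_def \<tau>_def)
  qed
  have "(\<Sum>i\<in>I. \<Sum>j\<in>J. (\<phi> i (\<Sum>n<M. ell1_unit n (ell1_nth (v j) n)))\<^sup>2) \<le> 128 * ?D\<^sup>2 * \<theta> * \<Gamma>" for M
  proof -
    \<comment> \<open>The Gram matrix of the coordinates. Its scalar form is a sum over
      \<open>J\<close> of products, controlled by \<open>sq\<close> and the arithmetic-geometric
      mean inequality; the vectors inserted into it are the images of the unit vectors
      \<open>?e p\<close> under the \<phi> i.\<close>
    define a where "a p q = (\<Sum>j\<in>J. crd p (v j) * crd q (v j))" for p q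
    have ex: "\<phi> i (\<Sum>n<M. ell1_unit n (ell1_nth y n)) = (\<Sum>p\<in>idx M. crd p y * \<phi> i (?e p))"
      if "i \<in> I" for i y
      unfolding crd_expansion[symmetric] linear_sum[OF lin[OF that]]
      by (simp add: linear_scale[OF lin[OF that]])
    have "(\<Sum>i\<in>I. \<Sum>j\<in>J. (\<phi> i (\<Sum>n<M. ell1_unit n (ell1_nth (v j) n)))\<^sup>2)
        = (\<Sum>i\<in>I. \<Sum>j\<in>J. \<Sum>p\<in>idx M. \<Sum>q\<in>idx M. crd p (v j) * crd q (v j) * (\<phi> i (?e p) * \<phi> i (?e q)))"
      by (simp add: ex power2_eq_square sum_product mult_ac)
    also have "\<dots> = (\<Sum>p\<in>idx M. \<Sum>q\<in>idx M. \<Sum>i\<in>I. \<Sum>j\<in>J. crd p (v j) * crd q (v j) * (\<phi> i (?e p) * \<phi> i (?e q)))"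
      by (simp only: sum.swap[of _ "idx M" J] sum.swap[of _ "idx M" I])
    also have "\<dots> = (\<Sum>p\<in>idx M. \<Sum>q\<in>idx M. a p q * (\<Sum>i\<in>I. \<phi> i (?e p) * \<phi> i (?e q)))"
      by (simp add: a_def sum_distrib_left sum_distrib_right sum.swap[of _ I J])
    also have "\<dots> \<le> 128 * (?D\<^sup>2 * \<theta>) * sqrt \<Gamma> * sqrt \<Gamma>"
    proof (rule Grothendieck_inequality)
      show "(\<Sum>p\<in>idx M. \<Sum>q\<in>idx M. a p q * (s p * t q)) \<le> ?D\<^sup>2 * \<theta>"
        if st: "\<And>p. \<bar>s p\<bar> \<le> 1" "\<And>q. \<bar>t q\<bar> \<le> 1" for s t
      proof -
        have "(\<Sum>p\<in>idx M. \<Sum>q\<in>idx M. a p q * (s p * t q))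
            = (\<Sum>j\<in>J. (\<Sum>p\<in>idx M. s p * crd p (v j)) * (\<Sum>q\<in>idx M. t q * crd q (v j)))"
          unfolding sum_product unfolding a_def sum_distrib_right
          by (simp only: sum.swap[of _ "idx M" J]) (simp add: mult_ac)
        also have "\<dots> \<le> (\<Sum>j\<in>J. ((\<Sum>p\<in>idx M. s p * crd p (v j))\<^sup>2 + (\<Sum>q\<in>idx M. t q * crd q (v j))\<^sup>2) / 2)"
        proof (intro sum_mono)
          show "y * z \<le> (y\<^sup>2 + z\<^sup>2) / 2" for y z :: real
            using sum_squares_bound[of y z] by simp
        qed
        also have "\<dots> \<le> ?D\<^sup>2 * \<theta>"
          using sq[of s M, OF st(1)] sq[of t M, OF st(2)]
          by (simp add: sum.distrib flip: sum_divide_distrib)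
        finally show ?thesis .
      qed
      show "(\<Sum>i\<in>I. (\<phi> i (?e p))\<^sup>2) \<le> (sqrt \<Gamma>)\<^sup>2" if "p \<in> idx M" for p
        using \<phi>[of "?e p"] that \<open>\<Gamma> \<ge> 0\<close> by auto
      then show "(\<Sum>i\<in>I. (\<phi> i (?e p))\<^sup>2) \<le> (sqrt \<Gamma>)\<^sup>2" if "p \<in> idx M" for p
        using that by blast
    qed (use fin \<open>\<Gamma> \<ge> 0\<close> in auto)
    also have "\<dots> = 128 * ?D\<^sup>2 * \<theta> * \<Gamma>" using \<open>\<Gamma> \<ge> 0\<close> by simp
    finally show ?thesis .
  qed
  \<comment> \<open>Each \<phi> i is continuous, since its square is one term of the bounded sum;
    hence the truncations of \<open>v j\<close> can be replaced by \<open>v j\<close> in the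
    limit.\<close>
  moreover have "(\<lambda>M. \<Sum>i\<in>I. \<Sum>j\<in>J. (\<phi> i (\<Sum>n<M. ell1_unit n (ell1_nth (v j) n)))\<^sup>2)
      \<longlonglongrightarrow> (\<Sum>i\<in>I. \<Sum>j\<in>J. (\<phi> i (v j))\<^sup>2)"
  proof (intro tendsto_intros)
    fix i j assume i: "i \<in> I"
    have "bounded_linear (\<phi> i)"
    proof (rule bounded_linear_intro[where K = "sqrt \<Gamma>"])
      fix y
      have "(\<phi> i y)\<^sup>2 \<le> (\<Sum>i\<in>I. (\<phi> i y)\<^sup>2)" by (rule member_le_sum[OF i]) (use fin in auto)
      also have "\<dots> \<le> \<Gamma> * (norm y)\<^sup>2" by (rule \<phi>)
      finally show "norm (\<phi> i y) \<le> norm y * sqrt \<Gamma>"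
        using real_sqrt_le_mono by (fastforce simp: real_sqrt_mult mult.commute)
    qed (use lin[OF i] in \<open>simp_all add: linear_add linear_scale\<close>)
    then show "(\<lambda>M. \<phi> i (\<Sum>n<M. ell1_unit n (ell1_nth (v j) n))) \<longlonglongrightarrow> \<phi> i (v j)"
      by (rule bounded_linear.tendsto[OF _ ell1_initial_LIMSEQ])
  qed
  ultimately show ?thesis by (intro LIMSEQ_le_const2) blast+
qed

section \<open>Multilinear maps and weak norms\<close>

lemma (in banach_space_over) scaleR_eq_scale: "r *\<^sub>R x = scale (of_real r) x"
  by (simp add: scale_of_real)

lemma linear_over_imp_linear:
  assumes "banach_space_over sE" "banach_space_over sF" "Vector_Spaces.linear sE sF f"
  shows "linear f"
  using assms(3) unfolding Vector_Spaces.linear_iff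
  by (intro linearI) (simp_all add: banach_space_over.scaleR_eq_scale[OF assms(1)]
      banach_space_over.scaleR_eq_scale[OF assms(2)])

lemma multilinear_maps_cong:
  assumes "T \<in> multilinear_maps sE sF m" "\<And>q. q < m \<Longrightarrow> x q = y q"
  shows "T x = T y"
  using assms by (simp add: multilinear_maps_def)

lemma multilinear_maps_linear:
  assumes "banach_space_over sE" "banach_space_over sF" "T \<in> multilinear_maps sE sF m" "q < m"
  shows "linear (\<lambda>v. T (x(q := v)))"
  using assms by (intro linear_over_imp_linear[of sE sF]) (simp_all add: multilinear_maps_def)

lemma multilinear_maps_scaleR:
  assumes "banach_space_over sE" "banach_space_over sF" "T \<in> multilinear_maps sE sF m" "n \<le> m"
  shows "T (\<lambda>q. if q < n then c q *\<^sub>R x q else x q) = (\<Prod>q<n. c q) *\<^sub>R T x"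
  using assms(4)
proof (induction n)
  case (Suc n)
  let ?g = "\<lambda>q. if q < n then c q *\<^sub>R x q else x q"
  have "(\<lambda>q. if q < Suc n then c q *\<^sub>R x q else x q) = ?g(n := c n *\<^sub>R x n)" by auto
  then have "T (\<lambda>q. if q < Suc n then c q *\<^sub>R x q else x q) = T (?g(n := c n *\<^sub>R x n))" by simp
  also have "\<dots> = c n *\<^sub>R T (?g(n := x n))"
    using Suc.prems by (intro linear_scale multilinear_maps_linear[OF assms(1-3)]) simp
  also have "?g(n := x n) = ?g" by auto
  finally show ?case using Suc by simp
qed simp

lemma multilinear_maps_eq_0:
  assumes "banach_space_over sE" "banach_space_over sF" "T \<in> multilinear_maps sE sF m" "q < m" "x q = 0"
  shows "T x = 0"
proof -
  have "T (x(q := 0)) = 0" by (intro linear_0 multilinear_maps_linear[OF assms(1-4)])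
  then show ?thesis using assms(5) by (metis fun_upd_triv)
qed

text \<open>Continuity at 0 gives a box of the product topology on which \<open>T\<close> has norm
  below 1. Scaling nonzero arguments to length \<open>\<delta> / 2\<close> and using homogeneity in
  every argument gives the constant.\<close>

lemma multilinear_maps_bounded:
  assumes T: "banach_space_over sE" "banach_space_over sF" "T \<in> multilinear_maps sE sF m" and "m > 0"
  obtains C where "C \<ge> 0" "\<And>x. norm (T x) \<le> C * (\<Prod>q<m. norm (x q))"
proof -
  have "open (T -` ball 0 1)"
    using T(3) by (intro open_vimage) (auto simp: multilinear_maps_def)
  then have "openin (product_topology (\<lambda>_. euclidean) UNIV) (T -` ball 0 1)"
    by (simp add: open_fun_def)
  moreover have "(\<lambda>_. 0) \<in> T -` ball 0 1"
    using multilinear_maps_eq_0[OF T, of 0 "\<lambda>_. 0"] \<open>m > 0\<close> by simp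
  ultimately obtain X where X: "(\<lambda>_. 0) \<in> Pi\<^sub>E UNIV X" "\<And>i. open (X i)" "Pi\<^sub>E UNIV X \<subseteq> T -` ball 0 1"
    using product_topology_open_contains_basis[of "\<lambda>_. euclidean" UNIV "T -` ball 0 1" "\<lambda>_. 0"]
    by (auto simp flip: open_openin)
  have "\<exists>d>0. \<forall>v. norm v < d \<longrightarrow> v \<in> X i" for i
  proof -
    have "0 \<in> X i" using X(1) by (simp add: PiE_UNIV_domain Pi_iff)
    then obtain e where "e > 0" "ball 0 e \<subseteq> X i" using X(2)[of i] open_contains_ball by blast
    then show ?thesis by (auto simp: subset_iff)
  qed
  then obtain d where d: "\<And>i. d i > 0" "\<And>i v. norm v < d i \<Longrightarrow> v \<in> X i" by metis
  define \<delta> where "\<delta> = Min (insert 1 (d ` {..<m}))"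
  have \<delta>: "\<delta> > 0" "\<And>q. q < m \<Longrightarrow> \<delta> \<le> d q" by (auto simp: \<delta>_def d)
  show thesis
  proof
    show "(2 / \<delta>) ^ m \<ge> 0" using \<delta> by simp
    fix x :: "nat \<Rightarrow> 'b"
    show "norm (T x) \<le> (2 / \<delta>) ^ m * (\<Prod>q<m. norm (x q))"
    proof (cases "\<exists>q<m. x q = 0")
      case True
      then show ?thesis using multilinear_maps_eq_0[OF T, of _ x] \<delta> by (auto simp: prod_nonneg)
    next
      case False
      define c where "c q = \<delta> / 2 / norm (x q)" for q
      \<comment> \<open>Coordinates from \<open>m\<close> on are set to 0, which lies in every
        factor of the box; \<open>T\<close> does not depend on them.\<close>
      let ?y = "\<lambda>q. if q < m then c q *\<^sub>R x q else 0"
      have "norm (c q *\<^sub>R x q) < d q" if "q < m" for q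
        using \<delta>(2)[OF that] \<delta>(1) False that by (auto simp: c_def)
      then have "?y \<in> Pi\<^sub>E UNIV X" using d by (auto simp: PiE_UNIV_domain)
      then have "norm (T ?y) < 1" using X(3) by auto
      also have "T ?y = T (\<lambda>q. if q < m then c q *\<^sub>R x q else x q)"
        by (rule multilinear_maps_cong[OF T(3)]) simp
      also have "\<dots> = (\<Prod>q<m. c q) *\<^sub>R T x" by (rule multilinear_maps_scaleR[OF T order_refl])
      also have "(\<Prod>q<m. c q) = (\<delta> / 2) ^ m / (\<Prod>q<m. norm (x q))"
        by (simp add: c_def prod_dividef prod.distrib power_divide)
      finally have "(\<delta> / 2) ^ m / (\<Prod>q<m. norm (x q)) * norm (T x) < 1"
        using \<delta>(1) by (simp add: prod_nonneg)
      moreover have "(\<Prod>q<m. norm (x q)) > 0" using False by (intro prod_pos) auto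
      ultimately show ?thesis using \<delta>(1) by (simp add: field_simps)
    qed
  qed
qed

section \<open>The dual ball and the weak norm\<close>

lemma dual_ball_norm_le: "\<phi> \<in> dual_ball sE \<Longrightarrow> norm (\<phi> v) \<le> norm v"
  unfolding dual_ball_def
  using onorm[of \<phi> v] mult_right_mono[of "onorm \<phi>" 1 "norm v"] by fastforce

lemma vector_space_times: "vector_space ((*) :: 'k::field \<Rightarrow> 'k \<Rightarrow> 'k)"
  by unfold_locales (simp_all add: algebra_simps)

lemma zero_in_dual_ball: "banach_space_over sE \<Longrightarrow> (\<lambda>_. 0) \<in> dual_ball sE"
  using vector_space_times
  by (auto simp: dual_ball_def Vector_Spaces.linear_iff banach_space_over_def onorm_zero)

lemma weak_norm1_upper:
  assumes "\<phi> \<in> dual_ball sE"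
  shows "(\<Sum>j<N. norm (\<phi> (x j))) \<le> weak_norm1 sE N x"
  unfolding weak_norm1_def
  by (rule cSUP_upper[OF assms], rule bdd_aboveI2[where M = "\<Sum>j<N. norm (x j)"])
    (intro sum_mono dual_ball_norm_le)

lemma weak_norm1_least:
  assumes "banach_space_over sE" "\<And>\<phi>. \<phi> \<in> dual_ball sE \<Longrightarrow> (\<Sum>j<N. norm (\<phi> (x j))) \<le> B"
  shows "weak_norm1 sE N x \<le> B"
  unfolding weak_norm1_def using zero_in_dual_ball[OF assms(1)] assms(2) by (intro cSUP_least) auto

lemma weak_norm1_nonneg: "banach_space_over sE \<Longrightarrow> weak_norm1 sE N x \<ge> 0"
  using weak_norm1_upper[OF zero_in_dual_ball, of sE N x] by simp

text \<open>A functional with coefficients of modulus at most 1 attains the norm of a truncation of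
  the sum and lies in the dual ball; the triangle inequality then moves it inside the sum.\<close>

lemma ell1_norm_signed_sum_le:
  fixes x :: "nat \<Rightarrow> 'k::{real_normed_field,banach} ell1"
  assumes "\<And>j. j < N \<Longrightarrow> \<bar>s j\<bar> \<le> 1"
  shows "norm (\<Sum>j<N. s j *\<^sub>R x j) \<le> weak_norm1 scale_ell1 N x"
proof (rule LIMSEQ_le_const2[OF ell1_norm_LIMSEQ], intro exI allI impI)
  fix M :: nat
  define y where "y = (\<Sum>j<N. s j *\<^sub>R x j)"
  define u where "u n = (if ell1_nth y n = 0 then 0 else of_real (norm (ell1_nth y n)) / ell1_nth y n)" for n
  define \<psi> where "\<psi> z = (\<Sum>n<M. u n * ell1_nth z n)" for z
  have u: "norm (u n) \<le> 1" for n by (simp add: u_def norm_divide)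
  have bound: "norm (\<psi> z) \<le> norm z" for z
  proof -
    have "norm (\<psi> z) \<le> (\<Sum>n<M. norm (u n) * norm (ell1_nth z n))"
      unfolding \<psi>_def by (rule order_trans[OF norm_sum]) (simp add: norm_mult)
    also have "\<dots> \<le> (\<Sum>n<M. 1 * norm (ell1_nth z n))" by (intro sum_mono mult_right_mono u) simp
    also have "\<dots> \<le> norm z" using ell1_sum_le_norm by simp
    finally show ?thesis .
  qed
  have bl: "bounded_linear \<psi>"
  proof (rule bounded_linear_intro[where K = 1])
    show "\<psi> (r *\<^sub>R z) = r *\<^sub>R \<psi> z" for r z by (simp add: \<psi>_def scaleR_sum_right)
  qed (use bound in \<open>auto simp: \<psi>_def algebra_simps sum.distrib\<close>)
  moreover have "Vector_Spaces.linear scale_ell1 (*) \<psi>"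
    unfolding Vector_Spaces.linear_iff
    by (auto simp: \<psi>_def algebra_simps sum.distrib sum_distrib_left scale_ell1.rep_eq
        ell1.vector_space_axioms vector_space_times)
  moreover have "onorm \<psi> \<le> 1" by (rule onorm_bound) (use bound in auto)
  ultimately have \<psi>: "\<psi> \<in> dual_ball scale_ell1" by (simp add: dual_ball_def)
  have "\<psi> y = (\<Sum>n<M. of_real (norm (ell1_nth y n)))"
    unfolding \<psi>_def by (intro sum.cong) (auto simp: u_def)
  then have "(\<Sum>n<M. norm (ell1_nth y n)) = norm (\<psi> y)"
    by (simp add: sum_nonneg flip: of_real_sum)
  also have "\<psi> y = (\<Sum>j<N. s j *\<^sub>R \<psi> (x j))"
    unfolding y_def using bl
    by (simp add: linear_sum linear_scale bounded_linear.linear)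
  also have "norm \<dots> \<le> (\<Sum>j<N. 1 * norm (\<psi> (x j)))"
    using assms by (intro order_trans[OF norm_sum] sum_mono) (simp add: mult_left_le_one_le)
  also have "\<dots> \<le> weak_norm1 scale_ell1 N x" using weak_norm1_upper[OF \<psi>] by simp
  finally show "(\<Sum>n<M. norm (ell1_nth (\<Sum>j<N. s j *\<^sub>R x j) n)) \<le> weak_norm1 scale_ell1 N x"
    by (simp add: y_def)
qed

lemma ell1_norm_signed_sum_subset_le:
  fixes x :: "nat \<Rightarrow> 'k::{real_normed_field,banach} ell1"
  assumes "A \<subseteq> {..<N}" "\<And>j. \<bar>s j\<bar> \<le> 1"
  shows "norm (\<Sum>j\<in>A. s j *\<^sub>R x j) \<le> weak_norm1 scale_ell1 N x"
proof -
  have "(\<Sum>j\<in>A. s j *\<^sub>R x j) = (\<Sum>j<N. (if j \<in> A then s j else 0) *\<^sub>R x j)"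
    using assms(1) by (intro sum.mono_neutral_cong_left) auto
  also have "norm \<dots> \<le> weak_norm1 scale_ell1 N x"
    using assms(2) by (intro ell1_norm_signed_sum_le) auto
  finally show ?thesis .
qed

lemma ell1_sum_norm_power2_le:
  fixes x :: "nat \<Rightarrow> 'k::{real_normed_field,euclidean_space} ell1"
  shows "(\<Sum>j<N. (norm (x j))\<^sup>2) \<le> (128 * real DIM('k) * weak_norm1 scale_ell1 N x)\<^sup>2"
  by (intro ell1_Orlicz ell1_norm_signed_sum_le) auto

lemma ell1_weak_norm1_eq_0D:
  fixes x :: "nat \<Rightarrow> 'k::{real_normed_field,euclidean_space} ell1"
  assumes "weak_norm1 scale_ell1 N x = 0" "j < N"
  shows "x j = 0"
proof -
  have "(\<Sum>j<N. (norm (x j))\<^sup>2) \<le> 0" using ell1_sum_norm_power2_le[of x N] assms by simp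
  then have "(\<Sum>j<N. (norm (x j))\<^sup>2) = 0" by (intro antisym sum_nonneg) auto
  then show ?thesis using assms(2) by (subst (asm) sum_nonneg_eq_0_iff) auto
qed

section \<open>Coincidence results\<close>

text \<open>After division of each factor by \<open>w q\<close>, the geometric mean of the
  \<open>m\<close> squares is at most their arithmetic mean; summation over \<open>j\<close> bounds
  the normalized left side by 1.\<close>

lemma Hoelder_roots_le:
  fixes u :: "nat \<Rightarrow> nat \<Rightarrow> real"
  assumes "m > 0" "\<And>q j. u q j \<ge> 0" "\<And>q. q < m \<Longrightarrow> w q > 0" "\<And>q. q < m \<Longrightarrow> (\<Sum>j<N. (u q j)\<^sup>2) \<le> (w q)\<^sup>2"
  shows "(\<Sum>j<N. (\<Prod>q<m. u q j) powr (2 / m)) \<le> (\<Prod>q<m. w q) powr (2 / m)"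
proof -
  have wpos: "prod w {..<m} > 0" using assms(3) by (intro prod_pos) auto
  have "(\<Sum>j<N. ((\<Prod>q<m. u q j) / (\<Prod>q<m. w q)) powr (2 / m)) \<le> (\<Sum>j<N. \<Sum>q<m. (u q j / w q)\<^sup>2 / m)"
  proof (rule sum_mono)
    fix j
    have "((\<Prod>q<m. u q j) / (\<Prod>q<m. w q)) powr (2 / m) = ((\<Prod>q<m. u q j / w q) powr 2) powr (1 / m)"
      by (simp add: powr_powr prod_dividef)
    also have "(\<Prod>q<m. u q j / w q) powr 2 = (\<Prod>q<m. (u q j / w q)\<^sup>2)"
      using assms(2,3) by (subst powr_numeral)
        (auto simp: prod_power_distrib less_imp_le intro!: prod_nonneg divide_nonneg_nonneg)
    also have "(\<Prod>q<m. (u q j / w q)\<^sup>2) powr (1 / m) \<le> (\<Sum>q<m. (u q j / w q)\<^sup>2 / m)"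
      using arith_geom_mean[of "{..<m}" "\<lambda>q. (u q j / w q)\<^sup>2"] \<open>m > 0\<close> by (simp add: lessThan_empty_iff)
    finally show "((\<Prod>q<m. u q j) / (\<Prod>q<m. w q)) powr (2 / m) \<le> (\<Sum>q<m. (u q j / w q)\<^sup>2 / m)" .
  qed
  also have "\<dots> = (\<Sum>q<m. (\<Sum>j<N. (u q j)\<^sup>2) / (w q)\<^sup>2 / m)"
    by (subst sum.swap) (simp add: power_divide sum_divide_distrib)
  also have "\<dots> \<le> (\<Sum>q<m. 1 / m)"
    using assms by (intro sum_mono divide_right_mono) (auto simp: divide_le_eq)
  also have "\<dots> = 1" using \<open>m > 0\<close> by simp
  finally have "(\<Sum>j<N. (\<Prod>q<m. u q j) powr (2 / m)) / (\<Prod>q<m. w q) powr (2 / m) \<le> 1"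
    using assms(2) wpos by (simp add: powr_divide prod_nonneg sum_divide_distrib)
  moreover have "prod w {..<m} powr (2 / m) > 0" using wpos by (metis powr_gt_zero less_irrefl)
  ultimately show ?thesis by (simp only: pos_divide_le_eq mult_1)
qed

text \<open>A vanishing weak norm forces its whole family to vanish, and with it all values of
  \<open>T\<close>. So it suffices to treat positive weak norms, before the root is taken.\<close>

lemma abs_summing_mapsI:
  fixes T :: "(nat \<Rightarrow> 'k::{real_normed_field,euclidean_space} ell1) \<Rightarrow> 'f::banach"
  assumes sF: "banach_space_over sF" and T: "T \<in> multilinear_maps scale_ell1 sF m" and "r > 0" "K \<ge> 0"
    and bound: "\<And>N x. (\<And>q. q < m \<Longrightarrow> weak_norm1 scale_ell1 N (x q) > 0)
      \<Longrightarrow> (\<Sum>j<N. norm (T (\<lambda>q. x q j)) powr r) \<le> (K * (\<Prod>q<m. weak_norm1 scale_ell1 N (x q))) powr r"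
  shows "T \<in> abs_summing_maps r scale_ell1 sF m"
  unfolding abs_summing_maps_def
proof (intro CollectI conjI T exI[of _ K] allI \<open>K \<ge> 0\<close>)
  fix N :: nat and x :: "nat \<Rightarrow> nat \<Rightarrow> 'k ell1"
  let ?w = "\<lambda>q. weak_norm1 scale_ell1 N (x q)"
  have w: "?w q \<ge> 0" for q by (rule weak_norm1_nonneg) unfold_locales
  show "(\<Sum>j<N. norm (T (\<lambda>q. x q j)) powr r) powr (1 / r) \<le> K * (\<Prod>q<m. ?w q)"
  proof (cases "\<exists>q<m. ?w q = 0")
    case True
    then obtain q where q: "q < m" "?w q = 0" by blast
    have "T (\<lambda>q. x q j) = 0" if "j < N" for j
      using q ell1_weak_norm1_eq_0D[OF q(2) that]
      by (intro multilinear_maps_eq_0[OF ell1.banach_space_over_axioms sF T]) auto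
    then show ?thesis using w \<open>K \<ge> 0\<close> by (simp add: prod_nonneg)
  next
    case False
    then have "(\<Sum>j<N. norm (T (\<lambda>q. x q j)) powr r) \<le> (K * (\<Prod>q<m. ?w q)) powr r"
      using w by (intro bound) (metis less_le)
    then have "(\<Sum>j<N. norm (T (\<lambda>q. x q j)) powr r) powr (1 / r) \<le> ((K * (\<Prod>q<m. ?w q)) powr r) powr (1 / r)"
      using \<open>r > 0\<close> by (intro powr_mono2) (auto simp: sum_nonneg)
    also have "\<dots> = K * (\<Prod>q<m. ?w q)"
      using \<open>r > 0\<close> \<open>K \<ge> 0\<close> w by (simp add: powr_powr prod_nonneg)
    finally show ?thesis .
  qed
qed

text \<open>Boundedness of \<open>T\<close> reduces the claim to the norms of the arguments. These
  are square summable by the Orlicz property, and Hoelder's inequality with \<open>m\<close> equal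
  exponents gives 2 / m for an arbitrary range.\<close>

lemma multilinear_ell1_abs_summing:
  fixes sF :: "'k::{real_normed_field,euclidean_space} \<Rightarrow> 'f::banach \<Rightarrow> 'f"
  assumes "m > 0" and sF: "banach_space_over sF" and T: "T \<in> multilinear_maps scale_ell1 sF m"
  shows "T \<in> abs_summing_maps (2 / real m) scale_ell1 sF m"
proof -
  obtain C where C: "C \<ge> 0" "\<And>x. norm (T x) \<le> C * (\<Prod>q<m. norm (x q))"
    using multilinear_maps_bounded[OF ell1.banach_space_over_axioms sF T \<open>m > 0\<close>] by blast
  define H where "H = 128 * real DIM('k)"
  have "H > 0" by (simp add: H_def)
  show ?thesis
  proof (rule abs_summing_mapsI[OF sF T, where K = "C * H ^ m"])
    fix N :: nat and x :: "nat \<Rightarrow> nat \<Rightarrow> 'k ell1"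
    let ?w = "\<lambda>q. weak_norm1 scale_ell1 N (x q)"
    assume w: "\<And>q. q < m \<Longrightarrow> ?w q > 0"
    have "(\<Sum>j<N. norm (T (\<lambda>q. x q j)) powr (2 / m)) \<le> (\<Sum>j<N. (C * (\<Prod>q<m. norm (x q j))) powr (2 / m))"
      by (intro sum_mono powr_mono2 C) auto
    also have "\<dots> = C powr (2 / m) * (\<Sum>j<N. (\<Prod>q<m. norm (x q j)) powr (2 / m))"
      using C(1) by (simp add: powr_mult prod_nonneg sum_distrib_left)
    also have "\<dots> \<le> C powr (2 / m) * (\<Prod>q<m. H * ?w q) powr (2 / m)"
      using \<open>m > 0\<close> \<open>H > 0\<close> w unfolding H_def
      by (intro mult_left_mono Hoelder_roots_le ell1_sum_norm_power2_le) auto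
    also have "\<dots> = (C * H ^ m * (\<Prod>q<m. ?w q)) powr (2 / m)"
      using C(1) \<open>H > 0\<close> w by (simp add: prod.distrib powr_mult prod_nonneg less_imp_le mult.assoc)
    finally show "(\<Sum>j<N. norm (T (\<lambda>q. x q j)) powr (2 / m)) \<le> (C * H ^ m * (\<Prod>q<m. ?w q)) powr (2 / m)" .
  qed (use \<open>m > 0\<close> C \<open>H > 0\<close> in auto)
qed

section \<open>Hilbert-valued maps: multiple 2-summability and weak-type bounds\<close>

definition crd2 :: "nat \<times> 'k \<Rightarrow> 'k::{real_normed_field,euclidean_space} ell2 \<Rightarrow> real"
  where "crd2 p y = ell2_nth y (fst p) \<bullet> snd p"

lemma linear_crd2: "linear (crd2 p)"
  by (rule linearI) (simp_all add: crd2_def inner_add_left)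

lemma sum_crd2_power2: "(\<Sum>p\<in>idx P. (crd2 p y)\<^sup>2) = (\<Sum>n<P. (norm (ell2_nth y n))\<^sup>2)"
proof -
  have "(norm a)\<^sup>2 = (\<Sum>b\<in>Basis. (a \<bullet> b)\<^sup>2)" for a :: 'a
    unfolding power2_norm_eq_inner by (subst euclidean_inner) (simp add: power2_eq_square)
  then show ?thesis by (simp add: sum.cartesian_product' crd2_def)
qed

lemma sum_crd2_power2_le: "(\<Sum>p\<in>idx P. (crd2 p y)\<^sup>2) \<le> (norm y)\<^sup>2"
  unfolding sum_crd2_power2 using ell2_L2_set_le_norm[of y P] by (simp add: L2_set_def sqrt_le_D)

lemma ell2_norm_power2_LIMSEQ: "(\<lambda>P. \<Sum>n<P. (norm (ell2_nth y n))\<^sup>2) \<longlonglongrightarrow> (norm y)\<^sup>2"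
  unfolding norm_ell2_def by (simp add: suminf_nonneg ell2_summable summable_LIMSEQ)

lemma sum_crd2_power2_LIMSEQ: "(\<lambda>P. \<Sum>p\<in>idx P. (crd2 p y)\<^sup>2) \<longlonglongrightarrow> (norm y)\<^sup>2"
  unfolding sum_crd2_power2 by (rule ell2_norm_power2_LIMSEQ)

text \<open>Multiple 2-summability: for fixed later variables,
  \<open>T\<close> with its first \<open>q\<close> variables running through the families is a linear map of the next variable
  into a larger Hilbert space.\<close>

lemma multiple_two_summing_aux:
  fixes T :: "(nat \<Rightarrow> 'k::{real_normed_field,euclidean_space} ell1) \<Rightarrow> 'k ell2"
    and v :: "nat \<Rightarrow> 'a \<Rightarrow> 'k ell1"
  assumes T: "T \<in> multilinear_maps scale_ell1 scale_ell2 m"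
    and C: "C \<ge> 0" "\<And>x. norm (T x) \<le> C * (\<Prod>q<m. norm (x q))" and "finite J"
    and v: "\<And>q t. q < m \<Longrightarrow> (norm (\<Sum>j\<in>J. t j *\<^sub>R v q j))\<^sup>2 \<le> \<theta> q * (\<Sum>j\<in>J. (t j)\<^sup>2)"
    and \<theta>: "\<And>q. q < m \<Longrightarrow> \<theta> q \<ge> 0"
    and "q \<le> m"
  shows "(\<Sum>p\<in>idx P. \<Sum>\<alpha>\<in>{..<q} \<rightarrow>\<^sub>E J. (crd2 p (T (\<lambda>r. if r < q then v r (\<alpha> r) else x r)))\<^sup>2)
    \<le> (\<Prod>r<q. 128 * (real DIM('k))\<^sup>2 * \<theta> r) * (C\<^sup>2 * (\<Prod>r\<in>{q..<m}. (norm (x r))\<^sup>2))"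
  using \<open>q \<le> m\<close>
proof (induction q arbitrary: x)
  case 0
  have "(\<Sum>p\<in>idx P. (crd2 p (T x))\<^sup>2) \<le> (norm (T x))\<^sup>2" by (rule sum_crd2_power2_le)
  also have "\<dots> \<le> (C * (\<Prod>q<m. norm (x q)))\<^sup>2" by (intro power_mono C) simp
  finally show ?case
    by (simp add: power_mult_distrib prod_power_distrib lessThan_atLeast0)
next
  case (Suc q)
  then have "q < m" by simp
  let ?I = "idx P \<times> ({..<q} \<rightarrow>\<^sub>E J)"
  define z where "z \<alpha> = (\<lambda>r. if r < q then v r (\<alpha> r) else x r)" for \<alpha>
  define \<phi> where "\<phi> = (\<lambda>(p, \<alpha>) y. crd2 p (T ((z \<alpha>)(q := y))))"
  define \<Gamma> where "\<Gamma> = (\<Prod>r<q. 128 * (real DIM('k))\<^sup>2 * \<theta> r) * (C\<^sup>2 * (\<Prod>r\<in>{Suc q..<m}. (norm (x r))\<^sup>2))"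
  have "(\<Sum>p\<in>idx P. \<Sum>\<alpha>\<in>{..<Suc q} \<rightarrow>\<^sub>E J. (crd2 p (T (\<lambda>r. if r < Suc q then v r (\<alpha> r) else x r)))\<^sup>2)
      = (\<Sum>p\<in>idx P. \<Sum>\<alpha>\<in>{..<q} \<rightarrow>\<^sub>E J. \<Sum>j\<in>J. (\<phi> (p, \<alpha>) (v q j))\<^sup>2)"
  proof -
    have "(\<lambda>r. if r < Suc q then v r ((\<alpha>(q := j)) r) else x r) = (z \<alpha>)(q := v q j)" for \<alpha> j
      by (auto simp: z_def fun_eq_iff)
    then show ?thesis unfolding sum_PiE_Suc \<phi>_def by simp
  qed
  also have "\<dots> = (\<Sum>i\<in>?I. \<Sum>j\<in>J. (\<phi> i (v q j))\<^sup>2)" by (simp only: sum.cartesian_product')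
  also have "\<dots> \<le> 128 * (real DIM('k))\<^sup>2 * \<theta> q * \<Gamma>"
  proof (rule ell1_hilbert_two_summing[OF \<open>finite J\<close>])
    show "finite ?I" using \<open>finite J\<close> by (simp add: finite_PiE)
    show "linear (\<phi> i)" for i
      using linear_compose[OF multilinear_maps_linear[OF ell1.banach_space_over_axioms
            ell2.banach_space_over_axioms T \<open>q < m\<close>] linear_crd2]
      by (simp add: \<phi>_def split_beta o_def)
    show "\<Gamma> \<ge> 0" using \<theta> \<open>q < m\<close> by (auto simp: \<Gamma>_def intro!: mult_nonneg_nonneg prod_nonneg)
    fix y
    have "(\<Sum>i\<in>?I. (\<phi> i y)\<^sup>2) = (\<Sum>p\<in>idx P. \<Sum>\<alpha>\<in>{..<q} \<rightarrow>\<^sub>E J. (crd2 p (T ((z \<alpha>)(q := y))))\<^sup>2)"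
      by (simp add: sum.cartesian_product' \<phi>_def)
    also have "(\<Sum>p\<in>idx P. \<Sum>\<alpha>\<in>{..<q} \<rightarrow>\<^sub>E J. (crd2 p (T ((z \<alpha>)(q := y))))\<^sup>2)
        = (\<Sum>p\<in>idx P. \<Sum>\<alpha>\<in>{..<q} \<rightarrow>\<^sub>E J. (crd2 p (T (\<lambda>r. if r < q then v r (\<alpha> r) else (x(q := y)) r)))\<^sup>2)"
    proof -
      have "(z \<alpha>)(q := y) = (\<lambda>r. if r < q then v r (\<alpha> r) else (x(q := y)) r)" for \<alpha>
        by (auto simp: z_def fun_eq_iff)
      then show ?thesis by simp
    qed
    \<comment> \<open>The induction hypothesis with \<open>y\<close> as the variable of index
      \<open>q\<close> is exactly the boundedness of \<phi> as a map into the larger Hilbert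
      space.\<close>
    also have "\<dots> \<le> (\<Prod>r<q. 128 * (real DIM('k))\<^sup>2 * \<theta> r) * (C\<^sup>2 * (\<Prod>r\<in>{q..<m}. (norm ((x(q := y)) r))\<^sup>2))"
      using Suc.prems by (intro Suc.IH) simp
    also have "(\<Prod>r\<in>{q..<m}. (norm ((x(q := y)) r))\<^sup>2) = (norm y)\<^sup>2 * (\<Prod>r\<in>{Suc q..<m}. (norm (x r))\<^sup>2)"
      using \<open>q < m\<close> by (subst prod.atLeast_Suc_lessThan) (auto intro!: prod.cong)
    finally show "(\<Sum>i\<in>?I. (\<phi> i y)\<^sup>2) \<le> \<Gamma> * (norm y)\<^sup>2" by (simp add: \<Gamma>_def mult_ac)
  qed (use v \<theta> \<open>q < m\<close> in auto)
  finally show ?case by (simp add: \<Gamma>_def mult_ac)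
qed

text \<open>Constant multi-indices single out the diagonal from the multiple sum, injectively
  because \<open>m > 0\<close>. The multiple bound with \<open>q = m\<close> is uniform in the
  number of coordinates of the range.\<close>

lemma diagonal_two_summing:
  fixes T :: "(nat \<Rightarrow> 'k::{real_normed_field,euclidean_space} ell1) \<Rightarrow> 'k ell2"
    and v :: "nat \<Rightarrow> 'a \<Rightarrow> 'k ell1"
  assumes T: "T \<in> multilinear_maps scale_ell1 scale_ell2 m" and "m > 0"
    and C: "C \<ge> 0" "\<And>x. norm (T x) \<le> C * (\<Prod>q<m. norm (x q))" and "finite J"
    and v: "\<And>q t. q < m \<Longrightarrow> (norm (\<Sum>j\<in>J. t j *\<^sub>R v q j))\<^sup>2 \<le> \<theta> q * (\<Sum>j\<in>J. (t j)\<^sup>2)"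
    and \<theta>: "\<And>q. q < m \<Longrightarrow> \<theta> q \<ge> 0"
  shows "(\<Sum>j\<in>J. (norm (T (\<lambda>q. v q j)))\<^sup>2) \<le> (\<Prod>q<m. 128 * (real DIM('k))\<^sup>2 * \<theta> q) * C\<^sup>2"
proof -
  have "(\<Sum>j\<in>J. \<Sum>p\<in>idx P. (crd2 p (T (\<lambda>q. v q j)))\<^sup>2) \<le> (\<Prod>q<m. 128 * (real DIM('k))\<^sup>2 * \<theta> q) * C\<^sup>2" for P
  proof -
    define h where "h j = (\<lambda>r\<in>{..<m}. j)" for j :: 'a
    have "inj_on h J" using \<open>m > 0\<close> unfolding h_def inj_on_def by (metis lessThan_iff restrict_apply')
    have "h ` J \<subseteq> {..<m} \<rightarrow>\<^sub>E J" unfolding h_def by (intro image_subsetI restrict_PiE_iff[THEN iffD2]) blast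
    have "(\<Sum>j\<in>J. \<Sum>p\<in>idx P. (crd2 p (T (\<lambda>q. v q j)))\<^sup>2)
        = (\<Sum>p\<in>idx P. \<Sum>j\<in>J. (crd2 p (T (\<lambda>r. if r < m then v r (h j r) else 0)))\<^sup>2)"
    proof (subst sum.swap, intro sum.cong refl)
      fix p j
      have "T (\<lambda>q. v q j) = T (\<lambda>r. if r < m then v r (h j r) else 0)"
        by (rule multilinear_maps_cong[OF T]) (simp add: h_def)
      then show "(crd2 p (T (\<lambda>q. v q j)))\<^sup>2 = (crd2 p (T (\<lambda>r. if r < m then v r (h j r) else 0)))\<^sup>2"
        by simp
    qed
    also have "\<dots> = (\<Sum>p\<in>idx P. \<Sum>\<alpha>\<in>h ` J. (crd2 p (T (\<lambda>r. if r < m then v r (\<alpha> r) else 0)))\<^sup>2)"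
      by (simp add: sum.reindex[OF \<open>inj_on h J\<close>])
    also have "\<dots> \<le> (\<Sum>p\<in>idx P. \<Sum>\<alpha>\<in>{..<m} \<rightarrow>\<^sub>E J. (crd2 p (T (\<lambda>r. if r < m then v r (\<alpha> r) else 0)))\<^sup>2)"
      using \<open>h ` J \<subseteq> _\<close> \<open>finite J\<close> by (intro sum_mono sum_mono2) (auto simp: finite_PiE)
    also have "\<dots> \<le> (\<Prod>r<m. 128 * (real DIM('k))\<^sup>2 * \<theta> r) * (C\<^sup>2 * (\<Prod>r\<in>{m..<m}. (norm (0::'k ell1))\<^sup>2))"
      by (rule multiple_two_summing_aux) (use assms in auto)
    finally show ?thesis by simp
  qed
  moreover have "(\<lambda>P. \<Sum>j\<in>J. \<Sum>p\<in>idx P. (crd2 p (T (\<lambda>q. v q j)))\<^sup>2)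
      \<longlonglongrightarrow> (\<Sum>j\<in>J. (norm (T (\<lambda>q. v q j)))\<^sup>2)"
    by (intro tendsto_intros sum_crd2_power2_LIMSEQ)
  ultimately show ?thesis by (intro LIMSEQ_le_const2) blast+
qed

text \<open>For each argument a small part of \<open>S\<close> is discarded so that the rest is
  dominated with a constant \<theta> q inversely proportional to \<open>card S\<close>. At least
  half of \<open>S\<close> survives all arguments, and diagonal 2-summability bounds the sum of the
  squares over it: the \<open>m\<close> factors \<theta> q and the number of terms yield the
  exponent \<open>m + 1\<close>.\<close>

lemma multilinear_ell2_weak_type:
  fixes T :: "(nat \<Rightarrow> 'k::{real_normed_field,euclidean_space} ell1) \<Rightarrow> 'k ell2"
  assumes T: "T \<in> multilinear_maps scale_ell1 scale_ell2 m" and "m > 0"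
  obtains K where "K \<ge> 0"
    "\<And>N x S t. (\<And>q. q < m \<Longrightarrow> weak_norm1 scale_ell1 N (x q) > 0) \<Longrightarrow> S \<subseteq> {..<N} \<Longrightarrow> S \<noteq> {} \<Longrightarrow>
      (\<And>j. j \<in> S \<Longrightarrow> t \<le> norm (T (\<lambda>q. x q j))) \<Longrightarrow> t \<ge> 0 \<Longrightarrow>
      t\<^sup>2 \<le> (K * (\<Prod>q<m. weak_norm1 scale_ell1 N (x q)))\<^sup>2 / real (card S) ^ (m + 1)"
proof -
  obtain C where C: "C \<ge> 0" "\<And>x. norm (T x) \<le> C * (\<Prod>q<m. norm (x q))"
    using multilinear_maps_bounded[OF ell1.banach_space_over_axioms ell2.banach_space_over_axioms T \<open>m > 0\<close>]
    by blast
  define D where "D = real DIM('k)"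
  define A where "A = 128 * D\<^sup>2 * (2 * m * (128 * D)\<^sup>2)"
  have "A \<ge> 0" by (simp add: A_def)
  show thesis
  proof
    show "sqrt (2 * A ^ m * C\<^sup>2) \<ge> 0" using \<open>A \<ge> 0\<close> by simp
    fix N S t and x :: "nat \<Rightarrow> nat \<Rightarrow> 'k ell1"
    let ?w = "\<lambda>q. weak_norm1 scale_ell1 N (x q)"
    assume w: "\<And>q. q < m \<Longrightarrow> ?w q > 0" and S: "S \<subseteq> {..<N}" "S \<noteq> {}"
      and t: "\<And>j. j \<in> S \<Longrightarrow> t \<le> norm (T (\<lambda>q. x q j))" "t \<ge> 0"
    define n where "n = real (card S)"
    have "finite S" using S finite_subset by blast
    then have n: "n > 0" using S by (simp add: n_def card_gt_0_iff)
    \<comment> \<open>The factor \<open>2 * m\<close> makes each argument discard at most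
      \<open>n / (2 * m)\<close> indices, hence all of them together at most half of
      \<open>S\<close>.\<close>
    define \<theta> where "\<theta> q = 2 * m * (128 * D * ?w q)\<^sup>2 / n" for q
    have \<theta>: "\<theta> q > 0" if "q < m" for q
      using w[OF that] n \<open>m > 0\<close> by (simp add: \<theta>_def D_def)
    define good where "good q J \<longleftrightarrow> J \<subseteq> S \<and> \<theta> q * card (S - J) \<le> (128 * D * ?w q)\<^sup>2
        \<and> (\<forall>t. (norm (\<Sum>j\<in>J. t j *\<^sub>R x q j))\<^sup>2 \<le> \<theta> q * (\<Sum>j\<in>J. (t j)\<^sup>2))" for q J
    have "\<exists>J. good q J" if "q < m" for q
      by (rule ell1_dominated_subset[OF \<open>finite S\<close> ell1_norm_signed_sum_subset_le[OF S(1), of _ "x q"]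
            \<theta>[OF that]]) (auto simp: D_def good_def)
    then obtain J where "\<And>q. q < m \<Longrightarrow> good q (J q)" by metis
    then have J: "\<And>q. q < m \<Longrightarrow> J q \<subseteq> S"
      "\<And>q. q < m \<Longrightarrow> \<theta> q * card (S - J q) \<le> (128 * D * ?w q)\<^sup>2"
      "\<And>q t. q < m \<Longrightarrow> (norm (\<Sum>j\<in>J q. t j *\<^sub>R x q j))\<^sup>2 \<le> \<theta> q * (\<Sum>j\<in>J q. (t j)\<^sup>2)"
      by (simp_all add: good_def)
    have small: "card (S - J q) \<le> n / (2 * m)" if "q < m" for q
    proof -
      have "(128 * D * ?w q)\<^sup>2 * (2 * m * card (S - J q)) \<le> (128 * D * ?w q)\<^sup>2 * n"
        using J(2)[OF that] n by (simp add: \<theta>_def field_simps)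
      moreover have "(128 * D * ?w q)\<^sup>2 > 0" using w[OF that] by (simp add: D_def)
      ultimately have "2 * m * card (S - J q) \<le> n" by (simp only: mult_le_cancel_left_pos)
      then show ?thesis using \<open>m > 0\<close> by (simp add: field_simps)
    qed
    define J0 where "J0 = S \<inter> (\<Inter>q<m. J q)"
    have J0: "J0 \<subseteq> S" "finite J0" using \<open>finite S\<close> by (auto simp: J0_def)
    have "S - J0 = (\<Union>q<m. S - J q)" by (auto simp: J0_def)
    then have "real (card (S - J0)) \<le> (\<Sum>q<m. card (S - J q))"
      using card_UN_le[of "{..<m}" "\<lambda>q. S - J q"] by (simp only: of_nat_le_iff) simp
    also have "\<dots> \<le> (\<Sum>q<m. n / (2 * m))" using small by (simp only: of_nat_sum) (intro sum_mono, simp)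
    also have "\<dots> = n / 2" using \<open>m > 0\<close> by simp
    finally have "n / 2 \<le> card J0"
      using J0 \<open>finite S\<close> card_mono[OF _ J0(1)] by (simp add: card_Diff_subset n_def of_nat_diff)
    then have "n / 2 * t\<^sup>2 \<le> card J0 * t\<^sup>2" by (intro mult_right_mono) auto
    then have "n / 2 * t\<^sup>2 \<le> (\<Sum>j\<in>J0. t\<^sup>2)" by simp
    also have "\<dots> \<le> (\<Sum>j\<in>J0. (norm (T (\<lambda>q. x q j)))\<^sup>2)"
      using t J0 by (intro sum_mono power_mono) auto
    also have "\<dots> \<le> (\<Prod>q<m. 128 * (real DIM('k))\<^sup>2 * \<theta> q) * C\<^sup>2"
    proof (rule diagonal_two_summing[OF T \<open>m > 0\<close> C \<open>finite J0\<close>])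
      fix q and s :: "nat \<Rightarrow> real" assume "q < m"
      then have "J0 \<subseteq> J q" "finite (J q)" using finite_subset[OF J(1) \<open>finite S\<close>] by (auto simp: J0_def)
      \<comment> \<open>Extension of \<open>s\<close> by zero transfers the domination from
        \<open>J q\<close> to \<open>J0\<close>.\<close>
      then have *: "(\<Sum>j\<in>J q. if j \<in> J0 then h j else 0) = (\<Sum>j\<in>J0. h j)"
        for h :: "nat \<Rightarrow> 'c::comm_monoid_add"
        by (intro sum.mono_neutral_cong_right) auto
      have "(norm (\<Sum>j\<in>J q. (if j \<in> J0 then s j else 0) *\<^sub>R x q j))\<^sup>2
          \<le> \<theta> q * (\<Sum>j\<in>J q. (if j \<in> J0 then s j else 0)\<^sup>2)"
        by (rule J(3)[OF \<open>q < m\<close>])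
      then show "(norm (\<Sum>j\<in>J0. s j *\<^sub>R x q j))\<^sup>2 \<le> \<theta> q * (\<Sum>j\<in>J0. (s j)\<^sup>2)"
        using *[of "\<lambda>j. s j *\<^sub>R x q j"] *[of "\<lambda>j. (s j)\<^sup>2"]
        by (simp add: if_distrib[of "\<lambda>c. c *\<^sub>R _"] if_distrib[of "\<lambda>c. c\<^sup>2"] cong: if_cong)
    qed (use \<theta> in \<open>auto intro: less_imp_le\<close>)
    also have "(\<Prod>q<m. 128 * (real DIM('k))\<^sup>2 * \<theta> q) = (\<Prod>q<m. A * (?w q)\<^sup>2 / n)"
      by (intro prod.cong) (simp_all add: \<theta>_def A_def D_def power_mult_distrib)
    also have "\<dots> = A ^ m * (\<Prod>q<m. ?w q)\<^sup>2 / n ^ m"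
      by (simp add: prod_dividef prod.distrib prod_power_distrib)
    finally have "t\<^sup>2 \<le> 2 * A ^ m * C\<^sup>2 * (\<Prod>q<m. ?w q)\<^sup>2 / n ^ (m + 1)"
      using n by (simp add: field_simps)
    then show "t\<^sup>2 \<le> (sqrt (2 * A ^ m * C\<^sup>2) * (\<Prod>q<m. ?w q))\<^sup>2 / real (card S) ^ (m + 1)"
      using \<open>A \<ge> 0\<close> by (simp add: n_def power_mult_distrib)
  qed
qed

text \<open>An index of small value is removed again and again; one removed while \<open>k\<close>
  indices remain contributes at most \<open>R powr r * k powr (- (b * r))\<close>. This replaces a
  decreasing rearrangement.\<close>

lemma sum_powr_le_if_weak_type:
  fixes a :: "'a \<Rightarrow> real"
  assumes "finite A" "r > 0" "R \<ge> 0" "\<And>j. a j \<ge> 0"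
    and "\<And>S. S \<subseteq> A \<Longrightarrow> S \<noteq> {} \<Longrightarrow> \<exists>j\<in>S. a j \<le> R * real (card S) powr (- b)"
  shows "(\<Sum>j\<in>A. a j powr r) \<le> R powr r * (\<Sum>k<card A. real (Suc k) powr (- (b * r)))"
  using assms(1,5)
proof (induction "card A" arbitrary: A)
  case (Suc n)
  then have "A \<noteq> {}" by auto
  then obtain i where i: "i \<in> A" "a i \<le> R * real (card A) powr (- b)" using Suc.prems(2)[of A] by auto
  have "(\<Sum>j\<in>A. a j powr r) = a i powr r + (\<Sum>j\<in>A - {i}. a j powr r)"
    using Suc.prems(1) i(1) by (rule sum.remove)
  also have "\<dots> \<le> (R * real (card A) powr (- b)) powr r
      + R powr r * (\<Sum>k<card (A - {i}). real (Suc k) powr (- (b * r)))"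
  proof (intro add_mono powr_mono2 Suc.hyps(1))
    show "n = card (A - {i})" using Suc.hyps(2) Suc.prems(1) i(1) by simp
    show "\<exists>j\<in>S. a j \<le> R * real (card S) powr (- b)" if "S \<subseteq> A - {i}" "S \<noteq> {}" for S
      using that by (intro Suc.prems(2)) auto
  qed (use assms Suc.prems i in auto)
  also have "card (A - {i}) = n" using Suc.hyps(2) Suc.prems(1) i(1) by simp
  also have "(R * real (card A) powr (- b)) powr r + R powr r * (\<Sum>k<n. real (Suc k) powr (- (b * r)))
      = R powr r * (\<Sum>k<card A. real (Suc k) powr (- (b * r)))"
    using \<open>R \<ge> 0\<close> Suc.hyps(2)[symmetric] by (simp add: powr_mult powr_powr algebra_simps)
  finally show ?case .
qed simp

text \<open>On any set \<open>S\<close> the smallest value plays the role of \<open>t\<close>, so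
  the weak-type bound holds with exponent \<open>b = (m + 1) / 2\<close>. The resulting series
  converges since \<open>b * r > 1\<close>.\<close>

lemma multilinear_ell2_abs_summing:
  fixes T :: "(nat \<Rightarrow> 'k::{real_normed_field,euclidean_space} ell1) \<Rightarrow> 'k ell2"
  assumes T: "T \<in> multilinear_maps scale_ell1 scale_ell2 m" and "m > 0" and r: "r > 2 / (real m + 1)"
  shows "T \<in> abs_summing_maps r scale_ell1 scale_ell2 m"
proof -
  obtain K where K: "K \<ge> 0"
    "\<And>N x S t. (\<And>q. q < m \<Longrightarrow> weak_norm1 scale_ell1 N (x q) > 0) \<Longrightarrow> S \<subseteq> {..<N} \<Longrightarrow> S \<noteq> {} \<Longrightarrow>
      (\<And>j. j \<in> S \<Longrightarrow> t \<le> norm (T (\<lambda>q. x q j))) \<Longrightarrow> t \<ge> 0 \<Longrightarrow>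
      t\<^sup>2 \<le> (K * (\<Prod>q<m. weak_norm1 scale_ell1 N (x q)))\<^sup>2 / real (card S) ^ (m + 1)"
    using multilinear_ell2_weak_type[OF T \<open>m > 0\<close>] by blast
  define b where "b = (real m + 1) / 2"
  have "r > 0" using r by (smt (verit) divide_nonneg_nonneg of_nat_0_le_iff)
  have "b * r > 1" using r by (simp add: b_def field_simps)
  then have "summable (\<lambda>k. real k powr (- (b * r)))" by (simp add: summable_real_powr_iff)
  then have summ: "summable (\<lambda>k. real (Suc k) powr (- (b * r)))" by (subst summable_Suc_iff)
  define Z where "Z = (\<Sum>k. real (Suc k) powr (- (b * r)))"
  have Z: "(\<Sum>k<n. real (Suc k) powr (- (b * r))) \<le> Z" for n
    unfolding Z_def by (rule sum_le_suminf[OF summ]) auto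
  have "Z \<ge> 0" using Z[of 0] by simp
  show ?thesis
  proof (rule abs_summing_mapsI[OF ell2.banach_space_over_axioms T \<open>r > 0\<close>, where K = "K * Z powr (1 / r)"])
    fix N and x :: "nat \<Rightarrow> nat \<Rightarrow> 'k ell1"
    let ?a = "\<lambda>j. norm (T (\<lambda>q. x q j))"
    assume w: "\<And>q. q < m \<Longrightarrow> weak_norm1 scale_ell1 N (x q) > 0"
    define R where "R = K * (\<Prod>q<m. weak_norm1 scale_ell1 N (x q))"
    have "R \<ge> 0" unfolding R_def
      by (intro mult_nonneg_nonneg prod_nonneg K(1) weak_norm1_nonneg ell1.banach_space_over_axioms ballI)
    have "(\<Sum>j<N. ?a j powr r) \<le> R powr r * (\<Sum>k<card {..<N}. real (Suc k) powr (- (b * r)))"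
    proof (rule sum_powr_le_if_weak_type)
      fix S assume S: "S \<subseteq> {..<N}" "S \<noteq> {}"
      then have "finite S" using finite_subset by blast
      then obtain i where i: "i \<in> S" "\<And>j. j \<in> S \<Longrightarrow> ?a i \<le> ?a j"
        using ex_min_if_finite[of "?a ` S"] S(2) by (force simp: not_less)
      have n: "real (card S) > 0" using \<open>finite S\<close> S(2) by (simp add: card_gt_0_iff)
      have "real (card S) ^ (m + 1) = real (card S) powr (real m + 1)"
        using n by (subst powr_realpow[symmetric]) (simp_all add: add.commute)
      also have "real m + 1 = b + b" by (simp add: b_def)
      also have "real (card S) powr (b + b) = (real (card S) powr b)\<^sup>2"
        by (simp only: powr_add power2_eq_square)
      finally have "(?a i)\<^sup>2 \<le> (R * real (card S) powr (- b))\<^sup>2"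
        using K(2)[OF w S i(2) norm_ge_zero] by (simp add: R_def powr_minus power_divide field_simps)
      then have "?a i \<le> R * real (card S) powr (- b)"
        by (rule power2_le_imp_le) (use \<open>R \<ge> 0\<close> in simp)
      then show "\<exists>j\<in>S. ?a j \<le> R * real (card S) powr (- b)" using i(1) by blast
    qed (use \<open>r > 0\<close> \<open>R \<ge> 0\<close> in auto)
    also have "\<dots> \<le> R powr r * Z" by (intro mult_left_mono Z) simp
    also have "\<dots> = (R * Z powr (1 / r)) powr r"
      using \<open>R \<ge> 0\<close> \<open>Z \<ge> 0\<close> \<open>r > 0\<close> by (simp add: powr_mult powr_powr)
    finally show "(\<Sum>j<N. ?a j powr r)
        \<le> (K * Z powr (1 / r) * (\<Prod>q<m. weak_norm1 scale_ell1 N (x q))) powr r"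
      by (simp add: R_def mult_ac)
  qed (use K(1) in simp)
qed

section \<open>Walsh matrices and sharpness\<close>

text \<open>The sign is -1 to the number of binary digits equal to 1 in both indices: the Sylvester
  form of a Hadamard matrix. Recursion on the last digits makes the matrix of order
  \<open>2 ^ k\<close> a corner of a single infinite one.\<close>

fun walsh :: "nat \<Rightarrow> nat \<Rightarrow> real" where
  "walsh i n = (if i = 0 then 1 else (if odd i \<and> odd n then - 1 else 1) * walsh (i div 2) (n div 2))"

declare walsh.simps [simp del]

lemma walsh_double:
  "walsh (2 * i) (2 * n) = walsh i n" "walsh (2 * i) (Suc (2 * n)) = walsh i n"
  "walsh (Suc (2 * i)) (2 * n) = walsh i n" "walsh (Suc (2 * i)) (Suc (2 * n)) = - walsh i n"
  by (auto simp: walsh.simps[of "2 * i"] walsh.simps[of "Suc (2 * i)"] walsh.simps[of 0])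

lemma abs_walsh: "\<bar>walsh i n\<bar> = 1"
proof (induction i n rule: walsh.induct)
  case (1 i n)
  then show ?case by (subst walsh.simps) (auto simp: abs_mult)
qed

lemma walsh_square: "walsh i n * walsh i n = 1"
  using abs_walsh[of i n] by (metis abs_mult_self_eq mult_1)

lemma sum_double: "(\<Sum>i<2 * n. f i) = (\<Sum>i<n. f (2 * i) + f (Suc (2 * i)))"
  for f :: "nat \<Rightarrow> 'a::comm_monoid_add"
  by (induction n) (simp_all add: add.assoc)

text \<open>Splitting both indices by parity leads to the sums and differences of neighbouring
  values of \<phi>, and the parallelogram identity adds the two halves. A general inner product
  space as range covers real and complex scalars at once.\<close>

lemma walsh_orthogonal:
  fixes \<phi> :: "nat \<Rightarrow> 'a::real_inner"
  shows "(\<Sum>i<2 ^ k. (norm (\<Sum>n<2 ^ k. walsh i n *\<^sub>R \<phi> n))\<^sup>2) = 2 ^ k * (\<Sum>n<2 ^ k. (norm (\<phi> n))\<^sup>2)"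
proof (induction k arbitrary: \<phi>)
  case 0
  then show ?case by (simp add: walsh.simps[of 0])
next
  case (Suc k)
  have par: "(norm (a + b))\<^sup>2 + (norm (a - b))\<^sup>2 = 2 * ((norm a)\<^sup>2 + (norm b)\<^sup>2)" for a b :: 'a
    unfolding power2_norm_eq_inner by (simp add: inner_add inner_diff inner_commute)
  have "(\<Sum>i<2 ^ Suc k. (norm (\<Sum>n<2 ^ Suc k. walsh i n *\<^sub>R \<phi> n))\<^sup>2)
      = (\<Sum>i<2 ^ k. (norm (\<Sum>n<2 ^ k. walsh i n *\<^sub>R (\<phi> (2 * n) + \<phi> (Suc (2 * n)))))\<^sup>2)
      + (\<Sum>i<2 ^ k. (norm (\<Sum>n<2 ^ k. walsh i n *\<^sub>R (\<phi> (2 * n) - \<phi> (Suc (2 * n)))))\<^sup>2)"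
    unfolding power_Suc sum_double walsh_double
    by (simp add: sum.distrib sum_subtractf sum_negf scaleR_right_distrib scaleR_right_diff_distrib)
  also have "\<dots> = 2 ^ k * (\<Sum>n<2 ^ k. 2 * ((norm (\<phi> (2 * n)))\<^sup>2 + (norm (\<phi> (Suc (2 * n))))\<^sup>2))"
    unfolding Suc.IH by (simp only: sum.distrib[symmetric] distrib_left[symmetric] par)
  also have "\<dots> = 2 ^ Suc k * (\<Sum>n<2 ^ Suc k. (norm (\<phi> n))\<^sup>2)"
    unfolding power_Suc sum_double by (simp add: sum_distrib_left algebra_simps)
  finally show ?case .
qed

definition walsh_row :: "nat \<Rightarrow> nat \<Rightarrow> 'k::real_normed_field ell1"
  where "walsh_row k i = (\<Sum>n<2 ^ k. ell1_unit n (of_real (walsh i n)))"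

lemma ell1_nth_walsh_row: "ell1_nth (walsh_row k i) n = (if n < 2 ^ k then of_real (walsh i n) else 0)"
  by (simp add: walsh_row_def ell1_nth_sum)

lemma norm_walsh_row: "norm (walsh_row k i :: 'k::real_normed_field ell1) = 2 ^ k"
proof -
  let ?r = "walsh_row k i :: 'k ell1"
  have "norm ?r = (\<Sum>n<2 ^ k. norm (ell1_nth ?r n))"
    unfolding norm_ell1_def by (rule suminf_finite) (auto simp: ell1_nth_walsh_row)
  also have "\<dots> = (\<Sum>n<(2::nat) ^ k. 1)" by (intro sum.cong) (auto simp: ell1_nth_walsh_row abs_walsh)
  finally show ?thesis by simp
qed

text \<open>A functional in the dual ball is at most 1 on unit vectors, so by orthogonality its
  values on the \<open>N\<close> rows have Euclidean norm at most \<open>N\<close>; Cauchy-Schwarz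
  costs a further \<open>sqrt N\<close>.\<close>

lemma weak_norm1_walsh_row_le:
  "weak_norm1 scale_ell1 (2 ^ k) (walsh_row k :: nat \<Rightarrow> 'k::{real_normed_field,euclidean_space} ell1)
    \<le> (2 ^ k) powr (3 / 2)"
proof (rule weak_norm1_least[OF ell1.banach_space_over_axioms])
  fix \<phi> :: "'k ell1 \<Rightarrow> 'k" assume \<phi>: "\<phi> \<in> dual_ball scale_ell1"
  define N where "N = (2::nat) ^ k"
  have lin: "linear \<phi>" using \<phi> by (simp add: dual_ball_def bounded_linear.linear)
  have "\<phi> (walsh_row k i) = (\<Sum>n<N. walsh i n *\<^sub>R \<phi> (ell1_unit n 1))" for i
  proof -
    have "ell1_unit n (of_real c) = c *\<^sub>R (ell1_unit n 1 :: 'k ell1)" for n c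
      by (rule ell1_eqI) (simp add: scaleR_conv_of_real)
    then show ?thesis by (simp add: walsh_row_def N_def linear_sum[OF lin] linear_scale[OF lin])
  qed
  then have "(\<Sum>i<N. (norm (\<phi> (walsh_row k i)))\<^sup>2) = N * (\<Sum>n<N. (norm (\<phi> (ell1_unit n 1)))\<^sup>2)"
    by (simp add: N_def walsh_orthogonal)
  also have "\<dots> \<le> N * (\<Sum>n<N. 1 :: real)"
    using dual_ball_norm_le[OF \<phi>, of "ell1_unit _ 1"]
    by (intro mult_left_mono sum_mono power_le_one) auto
  finally have "L2_set (\<lambda>i. norm (\<phi> (walsh_row k i))) {..<N} \<le> N"
    unfolding L2_set_def by (intro real_le_lsqrt) (auto simp: power2_eq_square sum_nonneg)
  moreover have "(\<Sum>i<N. \<bar>1\<bar> * \<bar>norm (\<phi> (walsh_row k i))\<bar>)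
      \<le> L2_set (\<lambda>_. 1) {..<N} * L2_set (\<lambda>i. norm (\<phi> (walsh_row k i))) {..<N}"
    by (rule L2_set_mult_ineq)
  ultimately have "(\<Sum>i<N. norm (\<phi> (walsh_row k i))) \<le> sqrt N * N"
    by (simp add: L2_set_constant) (meson mult_left_mono order_trans real_sqrt_ge_zero of_nat_0_le_iff)
  also have "\<dots> = N powr (1 / 2 + 1)"
    unfolding powr_add by (simp add: powr_half_sqrt)
  finally show "(\<Sum>j<2 ^ k. norm (\<phi> (walsh_row k j))) \<le> (2 ^ k) powr (3 / 2)"
    by (simp add: N_def)
qed

lemma weak_norm1_units_le:
  "weak_norm1 scale_ell1 N (\<lambda>j. ell1_unit (h j) 1 :: 'k::{real_normed_field,banach} ell1) \<le> N"
proof (rule weak_norm1_least[OF ell1.banach_space_over_axioms])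
  fix \<phi> :: "'k ell1 \<Rightarrow> 'k" assume "\<phi> \<in> dual_ball scale_ell1"
  then have "(\<Sum>j<N. norm (\<phi> (ell1_unit (h j) 1))) \<le> (\<Sum>j<N. 1)"
    using dual_ball_norm_le[of \<phi> scale_ell1 "ell1_unit _ 1"] by (intro sum_mono) auto
  then show "(\<Sum>j<N. norm (\<phi> (ell1_unit (h j) 1))) \<le> N" by simp
qed

text \<open>For \<open>N = 2 ^ k\<close> the summing inequality compares
  \<open>N powr (1 / r + \<alpha>)\<close> with \<open>C * N powr \<beta>\<close>; an excess in the
  exponent would make the quotient unbounded in \<open>k\<close>.\<close>

lemma abs_summing_exponent_le:
  assumes "T \<in> abs_summing_maps r sE sF m" "r > 0" "banach_space_over sE"
    and norm_T: "\<And>k j. norm (T (\<lambda>q. x k q j)) = (2 ^ k) powr \<alpha>"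
    and weak: "\<And>k. (\<Prod>q<m. weak_norm1 sE (2 ^ k) (x k q)) \<le> (2 ^ k) powr \<beta>"
  shows "1 / r + \<alpha> \<le> \<beta>"
proof (rule ccontr)
  assume neg: "\<not> ?thesis"
  obtain C where C: "C \<ge> 0" "\<And>N x. (\<Sum>j<N. norm (T (\<lambda>q. x q j)) powr r) powr (1 / r)
      \<le> C * (\<Prod>q<m. weak_norm1 sE N (x q))"
    using assms(1) unfolding abs_summing_maps_def by blast
  have "(2 ^ k) powr (1 / r + \<alpha> - \<beta>) \<le> C" for k :: nat
  proof -
    have "(2 ^ k) powr (1 / r + \<alpha>) = (2 ^ k * ((2 ^ k) powr \<alpha>) powr r) powr (1 / r)"
      using \<open>r > 0\<close> by (simp add: powr_add powr_mult powr_powr)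
    also have "\<dots> = (\<Sum>j<2 ^ k. norm (T (\<lambda>q. x k q j)) powr r) powr (1 / r)"
      by (simp add: norm_T)
    also have "\<dots> \<le> C * (\<Prod>q<m. weak_norm1 sE (2 ^ k) (x k q))" by (rule C)
    also have "\<dots> \<le> C * (2 ^ k) powr \<beta>" by (intro mult_left_mono weak C)
    finally show ?thesis by (simp add: powr_diff pos_divide_le_eq)
  qed
  then have bounded: "(2 powr (1 / r + \<alpha> - \<beta>)) ^ k \<le> C" for k
    by (simp add: powr_powr mult.commute flip: powr_realpow)
  have "2 powr (1 / r + \<alpha> - \<beta>) > 1" using neg by simp
  then obtain k where "C < (2 powr (1 / r + \<alpha> - \<beta>)) ^ k" using real_arch_pow by blast
  then show False using bounded[of k] by simp
qed

section \<open>Iterated bilinear maps and the tensor product\<close>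

primrec iterate_bilinear :: "('a \<Rightarrow> 'a \<Rightarrow> 'a) \<Rightarrow> nat \<Rightarrow> (nat \<Rightarrow> 'a) \<Rightarrow> 'a" where
  "iterate_bilinear B 0 x = x 0"
| "iterate_bilinear B (Suc n) x = B (iterate_bilinear B n x) (x (Suc n))"

lemma iterate_bilinear_cong:
  "(\<And>q. q \<le> n \<Longrightarrow> x q = y q) \<Longrightarrow> iterate_bilinear B n x = iterate_bilinear B n y"
  by (induction n) auto

text \<open>Level \<open>n\<close> uses the arguments 0 to \<open>n\<close>, hence the degree
  \<open>Suc n\<close>. The last argument enters the right slot of \<open>B\<close>; every earlier
  one sits inside the left slot, where the induction hypothesis applies.\<close>

lemma iterate_bilinear_multilinear:
  assumes "banach_space_over s" and bb: "bounded_bilinear B"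
    and scale: "\<And>c x y. B (s c x) y = s c (B x y)" "\<And>c x y. B x (s c y) = s c (B x y)"
  shows "iterate_bilinear B n \<in> multilinear_maps s s (Suc n)"
proof -
  interpret bb: bounded_bilinear B by (rule bb)
  have vs: "vector_space s" using assms(1) by (simp add: banach_space_over_def)
  have lin: "iterate_bilinear B n (x(q := u + v))
        = iterate_bilinear B n (x(q := u)) + iterate_bilinear B n (x(q := v))"
      "iterate_bilinear B n (x(q := s c u)) = s c (iterate_bilinear B n (x(q := u)))" if "q \<le> n" for q x u v c
  proof -
    have upd: "iterate_bilinear B n (x(Suc n := u)) = iterate_bilinear B n x" for n x u
      by (rule iterate_bilinear_cong) simp
    have "iterate_bilinear B n (x(q := u + v)) = iterate_bilinear B n (x(q := u)) + iterate_bilinear B n (x(q := v))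
        \<and> iterate_bilinear B n (x(q := s c u)) = s c (iterate_bilinear B n (x(q := u)))"
      using that
    proof (induction n)
      case (Suc n)
      show ?case
      proof (cases "q = Suc n")
        case True
        then show ?thesis by (simp only: iterate_bilinear.simps upd fun_upd_same bb.add_right scale simp_thms)
      next
        case False
        then have "q \<le> n" using Suc.prems by simp
        then show ?thesis using Suc.IH False by (simp add: bb.add_left scale)
      qed
    qed simp
    then show "iterate_bilinear B n (x(q := u + v))
        = iterate_bilinear B n (x(q := u)) + iterate_bilinear B n (x(q := v))"
      "iterate_bilinear B n (x(q := s c u)) = s c (iterate_bilinear B n (x(q := u)))" by auto
  qed
  have "continuous_on UNIV (iterate_bilinear B n)"
  proof (induction n)
    case (Suc n)
    then show ?case by (auto intro!: bb.continuous_on)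
  qed simp
  moreover have "iterate_bilinear B n x = iterate_bilinear B n y" if "\<forall>q<Suc n. x q = y q" for x y
    using that by (intro iterate_bilinear_cong) simp
  moreover have "Vector_Spaces.linear s s (\<lambda>v. iterate_bilinear B n (x(q := v)))" if "q < Suc n" for q x
    unfolding Vector_Spaces.linear_iff using vs lin that by auto
  ultimately show ?thesis unfolding multilinear_maps_def by blast
qed

text \<open>The first \<open>P\<close> pairs of the enumeration lie in a square block, over which
  the double sum factors.\<close>

lemma sum_prod_decode_le:
  fixes x y :: "'k::real_normed_field ell1"
  shows "(\<Sum>n<P. norm (ell1_nth x (fst (prod_decode n)) * ell1_nth y (snd (prod_decode n)))) \<le> norm x * norm y"
proof -
  let ?S = "prod_decode ` {..<P}"
  obtain A where A: "fst ` ?S \<union> snd ` ?S \<subseteq> {..<A}"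
    using finite_nat_bounded[of "fst ` ?S \<union> snd ` ?S"] by auto
  have "(\<Sum>n<P. norm (ell1_nth x (fst (prod_decode n)) * ell1_nth y (snd (prod_decode n))))
      = (\<Sum>(a, b)\<in>?S. norm (ell1_nth x a) * norm (ell1_nth y b))"
    by (subst sum.reindex) (auto simp: inj_prod_decode norm_mult split_beta)
  also have "\<dots> \<le> (\<Sum>(a, b)\<in>{..<A} \<times> {..<A}. norm (ell1_nth x a) * norm (ell1_nth y b))"
    using A by (intro sum_mono2) (auto simp: image_subset_iff mem_Times_iff)
  also have "\<dots> = (\<Sum>a<A. norm (ell1_nth x a)) * (\<Sum>b<A. norm (ell1_nth y b))"
    by (simp add: sum_product sum.cartesian_product)
  also have "\<dots> \<le> norm x * norm y" by (intro mult_mono ell1_sum_le_norm) (auto simp: sum_nonneg)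
  finally show ?thesis .
qed

text \<open>The elementary tensor of \<open>x\<close> and \<open>y\<close> in the doubly indexed
  space, brought back to sequences by the pairing function so that the product can be
  iterated.\<close>

lift_definition ell1_tensor :: "'k::real_normed_field ell1 \<Rightarrow> 'k ell1 \<Rightarrow> 'k ell1"
  is "\<lambda>x y n. x (fst (prod_decode n)) * y (snd (prod_decode n))"
proof -
  fix x y :: "nat \<Rightarrow> 'k" assume "summable (\<lambda>n. norm (x n))" "summable (\<lambda>n. norm (y n))"
  then show "summable (\<lambda>n. norm (x (fst (prod_decode n)) * y (snd (prod_decode n))))"
    using sum_prod_decode_le[of "Ell1 x" "Ell1 y"]
    by (intro summableI_nonneg_bounded) (auto simp: Ell1_inverse)
qed

lemma norm_ell1_tensor: "norm (ell1_tensor x y) = norm x * norm y"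
proof (rule antisym)
  show "norm (ell1_tensor x y) \<le> norm x * norm y"
    by (rule LIMSEQ_le_const2[OF ell1_norm_LIMSEQ]) (auto simp: ell1_tensor.rep_eq sum_prod_decode_le)
  have "(\<lambda>M. (\<Sum>a<M. norm (ell1_nth x a)) * (\<Sum>b<M. norm (ell1_nth y b))) \<longlonglongrightarrow> norm x * norm y"
    by (intro tendsto_intros ell1_norm_LIMSEQ)
  then show "norm x * norm y \<le> norm (ell1_tensor x y)"
  proof (rule LIMSEQ_le_const2, intro exI allI impI)
    fix M :: nat
    have "(\<Sum>a<M. norm (ell1_nth x a)) * (\<Sum>b<M. norm (ell1_nth y b))
        = (\<Sum>p\<in>{..<M} \<times> {..<M}. norm (ell1_nth (ell1_tensor x y) (prod_encode p)))"
      by (simp add: sum_product sum.cartesian_product ell1_tensor.rep_eq norm_mult split_beta)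
    also have "\<dots> = (\<Sum>n\<in>prod_encode ` ({..<M} \<times> {..<M}). norm (ell1_nth (ell1_tensor x y) n))"
      by (simp add: sum.reindex inj_prod_encode)
    also have "\<dots> \<le> norm (ell1_tensor x y)"
      unfolding norm_ell1_def by (intro sum_le_suminf ell1_summable) auto
    finally show "(\<Sum>a<M. norm (ell1_nth x a)) * (\<Sum>b<M. norm (ell1_nth y b)) \<le> norm (ell1_tensor x y)" .
  qed
qed

lemma iterate_tensor_multilinear:
  "iterate_bilinear ell1_tensor n
    \<in> multilinear_maps scale_ell1 (scale_ell1 :: 'k::{real_normed_field,banach} \<Rightarrow> _) (Suc n)"
proof (rule iterate_bilinear_multilinear[OF ell1.banach_space_over_axioms])
  show "bounded_bilinear (ell1_tensor :: 'k ell1 \<Rightarrow> _)"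
  proof
    show "\<exists>K. \<forall>a b :: 'k ell1. norm (ell1_tensor a b) \<le> norm a * norm b * K"
      by (rule exI[of _ 1]) (simp add: norm_ell1_tensor)
  qed (rule ell1_eqI, simp add: ell1_tensor.rep_eq algebra_simps)+
qed (rule ell1_eqI, simp add: ell1_tensor.rep_eq scale_ell1.rep_eq algebra_simps)+

lemma norm_iterate_tensor: "norm (iterate_bilinear ell1_tensor n x) = (\<Prod>q<Suc n. norm (x q))"
  by (induction n) (simp_all add: norm_ell1_tensor)

text \<open>With Walsh rows in all arguments and \<open>N = 2 ^ k\<close>, the values have norm
  \<open>N ^ m\<close> and the weak norms have product at most \<open>N powr (3 / 2 * m)\<close>, so
  \<open>1 / r\<close> is at most \<open>m / 2\<close>.\<close>

lemma ell1_exponent_ge: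
  assumes "m > 0" "r > 0"
    and "multilinear_maps scale_ell1 (scale_ell1 :: 'k::{real_normed_field,euclidean_space} \<Rightarrow> _) m
      = abs_summing_maps r scale_ell1 scale_ell1 m"
  shows "r \<ge> 2 / real m"
proof -
  obtain n where m: "m = Suc n" using \<open>m > 0\<close> gr0_implies_Suc by blast
  let ?T = "iterate_bilinear (ell1_tensor :: 'k ell1 \<Rightarrow> _) n"
  have "1 / r + real m \<le> 3 / 2 * m"
  proof (rule abs_summing_exponent_le[where T = ?T and x = "\<lambda>k q. walsh_row k"])
    show "?T \<in> abs_summing_maps r scale_ell1 scale_ell1 m"
      using iterate_tensor_multilinear[of n] assms(3) m by blast
    show "norm (?T (\<lambda>q. walsh_row k j)) = (2 ^ k) powr real m" for k j
      by (simp add: norm_iterate_tensor norm_walsh_row m powr_realpow del: of_nat_Suc)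
    show "(\<Prod>q<m. weak_norm1 scale_ell1 (2 ^ k) (walsh_row k :: nat \<Rightarrow> 'k ell1)) \<le> (2 ^ k) powr (3 / 2 * m)" for k
    proof -
      have "weak_norm1 scale_ell1 (2 ^ k) (walsh_row k :: nat \<Rightarrow> 'k ell1) ^ m \<le> ((2 ^ k) powr (3 / 2)) ^ m"
        by (intro power_mono weak_norm1_walsh_row_le weak_norm1_nonneg ell1.banach_space_over_axioms)
      then show ?thesis by (simp add: powr_power mult.commute)
    qed
  qed (use \<open>r > 0\<close> ell1.banach_space_over_axioms in auto)
  then show ?thesis using \<open>r > 0\<close> \<open>m > 0\<close> by (simp add: field_simps)
qed

text \<open>The coordinate with index \<open>prod_encode (k, i)\<close> of the second argument is tested against the
  \<open>i\<close>-th row of the \<open>k\<close>-th Walsh matrix, so that a single bilinear map serves all \<open>k\<close>.\<close>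

definition walsh_functional :: "nat \<Rightarrow> 'k::real_normed_field ell1 \<Rightarrow> 'k"
  where "walsh_functional p z = (case prod_decode p of (k, i) \<Rightarrow> \<Sum>n<2 ^ k. of_real (walsh i n) * ell1_nth z n)"

lemma walsh_functional_linear:
  "walsh_functional p (y + z) = walsh_functional p y + walsh_functional p z"
  "walsh_functional p (r *\<^sub>R z) = r *\<^sub>R walsh_functional p z"
  "walsh_functional p (scale_ell1 c z) = c * walsh_functional p z"
  by (simp_all add: walsh_functional_def split_beta sum.distrib algebra_simps scaleR_sum_right
      sum_distrib_left scale_ell1.rep_eq)

lemma norm_walsh_functional_le: "norm (walsh_functional p z) \<le> norm z"
proof -
  obtain k i where p: "prod_decode p = (k, i)" by fastforce
  have "norm (walsh_functional p z) \<le> (\<Sum>n<2 ^ k. norm (ell1_nth z n))"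
    unfolding walsh_functional_def p prod.case
    by (rule order_trans[OF norm_sum]) (simp add: norm_mult abs_walsh)
  also have "\<dots> \<le> norm z" by (rule ell1_sum_le_norm)
  finally show ?thesis .
qed

text \<open>In the lifted function \<open>z\<close> is a bare sequence, hence the wrapping by
  \<open>Ell1\<close>. The result stays in \<open>ell1\<close> because the functionals are uniformly
  bounded, which allows iteration.\<close>

lift_definition walsh_bilinear :: "'k::real_normed_field ell1 \<Rightarrow> 'k ell1 \<Rightarrow> 'k ell1"
  is "\<lambda>u z p. u p * walsh_functional p (Ell1 z)"
proof -
  fix u z :: "nat \<Rightarrow> 'k" assume u: "summable (\<lambda>n. norm (u n))"
  show "summable (\<lambda>p. norm (u p * walsh_functional p (Ell1 z)))"
  proof (rule summable_comparison_test'[OF summable_mult[OF u, of "norm (Ell1 z)"]])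
    show "norm (norm (u p * walsh_functional p (Ell1 z))) \<le> norm (Ell1 z) * norm (u p)" for p
      using norm_walsh_functional_le[of p "Ell1 z"] by (simp add: norm_mult mult.commute mult_left_mono)
  qed
qed

lemma ell1_nth_walsh_bilinear: "ell1_nth (walsh_bilinear u z) p = ell1_nth u p * walsh_functional p z"
  by (simp add: walsh_bilinear.rep_eq ell1_nth_inverse)

lemma norm_walsh_bilinear_le: "norm (walsh_bilinear u z) \<le> norm u * norm z"
proof (rule LIMSEQ_le_const2[OF ell1_norm_LIMSEQ], intro exI allI impI)
  fix M :: nat
  have "(\<Sum>p<M. norm (ell1_nth (walsh_bilinear u z) p)) \<le> (\<Sum>p<M. norm (ell1_nth u p) * norm z)"
    unfolding ell1_nth_walsh_bilinear norm_mult
    by (intro sum_mono mult_left_mono norm_walsh_functional_le) simp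
  also have "\<dots> \<le> norm u * norm z"
    unfolding sum_distrib_right[symmetric] by (intro mult_right_mono ell1_sum_le_norm) simp
  finally show "(\<Sum>p<M. norm (ell1_nth (walsh_bilinear u z) p)) \<le> norm u * norm z" .
qed

lemma iterate_walsh_multilinear:
  "iterate_bilinear walsh_bilinear n
    \<in> multilinear_maps scale_ell1 (scale_ell1 :: 'k::{real_normed_field,banach} \<Rightarrow> _) (Suc n)"
proof (rule iterate_bilinear_multilinear[OF ell1.banach_space_over_axioms])
  show "bounded_bilinear (walsh_bilinear :: 'k ell1 \<Rightarrow> _)"
  proof
    show "\<exists>K. \<forall>a b :: 'k ell1. norm (walsh_bilinear a b) \<le> norm a * norm b * K"
      by (rule exI[of _ 1]) (simp add: norm_walsh_bilinear_le)
  qed (rule ell1_eqI, simp add: ell1_nth_walsh_bilinear walsh_functional_linear algebra_simps)+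
qed (rule ell1_eqI, simp add: ell1_nth_walsh_bilinear walsh_functional_linear scale_ell1.rep_eq algebra_simps)+

lemma walsh_functional_walsh_row:
  "walsh_functional (prod_encode (k, i)) (walsh_row k i) = of_real (2 ^ k)"
proof -
  have "walsh_functional (prod_encode (k, i)) (walsh_row k i)
      = (\<Sum>n<2 ^ k. of_real (walsh i n * walsh i n) :: 'a)"
    unfolding walsh_functional_def by (simp add: ell1_nth_walsh_row)
  then show ?thesis by (simp add: walsh_square flip: of_real_mult)
qed

text \<open>The first argument selects one coordinate, and each Walsh row multiplies it by its
  pairing with itself, which is \<open>2 ^ k\<close>.\<close>

lemma iterate_walsh_rows:
  "iterate_bilinear walsh_bilinear n
      (\<lambda>q. if q = 0 then ell1_unit (prod_encode (k, i)) 1 else walsh_row k i)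
    = ell1_unit (prod_encode (k, i)) (of_real ((2 ^ k) ^ n))"
proof (induction n)
  case (Suc n)
  then show ?case
    by (intro ell1_eqI) (simp add: ell1_nth_walsh_bilinear walsh_functional_walsh_row)
qed simp

section \<open>The inclusion into \<open>ell2\<close> and the lower bound for Hilbert range\<close>

lift_definition ell1_to_ell2 :: "'k::real_normed_field ell1 \<Rightarrow> 'k ell2" is "\<lambda>x. x"
proof -
  fix x :: "nat \<Rightarrow> 'k" assume s: "summable (\<lambda>n. norm (x n))"
  show "summable (\<lambda>n. (norm (x n))\<^sup>2)"
  proof (rule summable_comparison_test'[OF summable_mult[OF s, of "norm (Ell1 x)"]])
    show "norm ((norm (x n))\<^sup>2) \<le> norm (Ell1 x) * norm (x n)" for n
      using ell1_nth_le_norm[of "Ell1 x" n] s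
      by (simp add: Ell1_inverse power2_eq_square mult_right_mono)
  qed
qed

lemma norm_ell1_to_ell2_le: "norm (ell1_to_ell2 x) \<le> norm x"
proof (rule LIMSEQ_le_const2[OF L2_set_tendsto_norm_ell2], intro exI allI impI)
  fix N :: nat
  have "L2_set (\<lambda>n. norm (ell2_nth (ell1_to_ell2 x) n)) {..<N} \<le> (\<Sum>n<N. \<bar>norm (ell1_nth x n)\<bar>)"
    unfolding ell1_to_ell2.rep_eq by (rule L2_set_le_sum_abs)
  also have "\<dots> \<le> norm x" using ell1_sum_le_norm by simp
  finally show "L2_set (\<lambda>n. norm (ell2_nth (ell1_to_ell2 x) n)) {..<N} \<le> norm x" .
qed

lemma norm_ell1_to_ell2_unit: "norm (ell1_to_ell2 (ell1_unit n a)) = norm a"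
proof (rule antisym)
  show "norm (ell1_to_ell2 (ell1_unit n a)) \<le> norm a" using norm_ell1_to_ell2_le[of "ell1_unit n a"] by simp
  show "norm a \<le> norm (ell1_to_ell2 (ell1_unit n a))"
    using ell2_nth_le_norm[of "ell1_to_ell2 (ell1_unit n a)" n] by (simp add: ell1_to_ell2.rep_eq)
qed

lemma bounded_linear_ell1_to_ell2: "bounded_linear ell1_to_ell2"
  by (rule bounded_linear_intro[where K = 1])
    (auto intro!: ell2_eqI simp: ell1_to_ell2.rep_eq norm_ell1_to_ell2_le)

lemma ell1_to_ell2_comp_multilinear:
  assumes "T \<in> multilinear_maps scale_ell1 (scale_ell1 :: 'k::{real_normed_field,banach} \<Rightarrow> _) m"
  shows "(\<lambda>x. ell1_to_ell2 (T x)) \<in> multilinear_maps scale_ell1 scale_ell2 m"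
proof -
  have "ell1_to_ell2 (scale_ell1 c x) = scale_ell2 c (ell1_to_ell2 x)" for c :: 'k and x
    by (rule ell2_eqI) (simp add: ell1_to_ell2.rep_eq scale_ell1.rep_eq scale_ell2.rep_eq)
  then show ?thesis
    using assms unfolding multilinear_maps_def Vector_Spaces.linear_iff
    by (auto simp: ell2.vector_space_axioms linear_add[OF bounded_linear.linear[OF bounded_linear_ell1_to_ell2]]
        intro: arg_cong[where f = ell1_to_ell2] bounded_linear.continuous_on[OF bounded_linear_ell1_to_ell2])
qed

text \<open>For \<open>N = 2 ^ k\<close> the \<open>n = m - 1\<close> Walsh rows give values of norm
  \<open>N ^ n\<close> and weak norms with product at most \<open>N powr (3 / 2 * n)\<close>; the
  unit vectors add a weak norm of at most \<open>N\<close>. Hence \<open>1 / r\<close> is at most 1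
  + n / 2 = (m + 1) / 2.\<close>

lemma ell2_exponent_ge:
  assumes "m > 0" "r > 0"
    and "multilinear_maps scale_ell1 (scale_ell2 :: 'k::{real_normed_field,euclidean_space} \<Rightarrow> _) m
      = abs_summing_maps r scale_ell1 scale_ell2 m"
  shows "r \<ge> 2 / (real m + 1)"
proof -
  obtain n where m: "m = Suc n" using \<open>m > 0\<close> gr0_implies_Suc by blast
  let ?T = "\<lambda>x. ell1_to_ell2 (iterate_bilinear (walsh_bilinear :: 'k ell1 \<Rightarrow> _) n x)"
  let ?x = "\<lambda>k q j. if q = 0 then ell1_unit (prod_encode (k, j)) 1 else walsh_row k j :: 'k ell1"
  have "1 / r + real n \<le> 1 + 3 / 2 * n"
  proof (rule abs_summing_exponent_le[where T = ?T and x = ?x])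
    show "?T \<in> abs_summing_maps r scale_ell1 scale_ell2 m"
      using ell1_to_ell2_comp_multilinear[OF iterate_walsh_multilinear[of n]] assms(3) m by blast
    show "norm (?T (\<lambda>q. ?x k q j)) = (2 ^ k) powr real n" for k j
      by (simp add: iterate_walsh_rows norm_ell1_to_ell2_unit norm_power powr_realpow)
    show "(\<Prod>q<m. weak_norm1 scale_ell1 (2 ^ k) (?x k q)) \<le> (2 ^ k) powr (1 + 3 / 2 * n)" for k
    proof -
      have "(\<Prod>q<m. weak_norm1 scale_ell1 (2 ^ k) (?x k q))
          = weak_norm1 scale_ell1 (2 ^ k) (\<lambda>j. ell1_unit (prod_encode (k, j)) 1 :: 'k ell1)
            * weak_norm1 scale_ell1 (2 ^ k) (walsh_row k :: nat \<Rightarrow> 'k ell1) ^ n"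
        unfolding m by (simp add: prod.lessThan_Suc_shift del: prod.lessThan_Suc)
      also have "\<dots> \<le> 2 ^ k * ((2 ^ k) powr (3 / 2)) ^ n"
        using weak_norm1_units_le[of "2 ^ k" "\<lambda>j. prod_encode (k, j)", where 'k='k]
        by (intro mult_mono power_mono weak_norm1_walsh_row_le zero_le_power weak_norm1_nonneg
            ell1.banach_space_over_axioms) auto
      also have "\<dots> = (2 ^ k) powr (1 + 3 / 2 * n)" by (simp add: powr_power powr_add mult_ac)
      finally show ?thesis .
    qed
  qed (use \<open>r > 0\<close> ell1.banach_space_over_axioms in auto)
  then show ?thesis using \<open>r > 0\<close> by (simp add: m field_simps)
qed

section \<open>Cotype\<close>

lemma L2_set_sum_le: "L2_set (\<lambda>j. \<Sum>n\<in>B. f n j) A \<le> (\<Sum>n\<in>B. L2_set (f n) A)"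
proof (induction B rule: infinite_finite_induct)
  case (insert b B)
  then show ?case using L2_set_triangle_ineq[of "f b" "\<lambda>j. \<Sum>n\<in>B. f n j" A] by simp
qed (auto simp: L2_set_def)

text \<open>Minkowski's inequality takes the sum over coordinates out of the Euclidean norm, and
  Khinchine's inequality applies in each coordinate.\<close>

lemma ell1_signs_norm_ge:
  fixes x :: "nat \<Rightarrow> 'k::{real_normed_field,euclidean_space} ell1"
  shows "L2_set (\<lambda>j. norm (x j)) {..<N} \<le> 2 * ((\<Sum>\<epsilon>\<in>signs N. norm (\<Sum>j<N. \<epsilon> j *\<^sub>R x j)) / 2 ^ N)"
proof -
  have lim: "(\<lambda>M. L2_set (\<lambda>j. \<Sum>n<M. norm (ell1_nth (x j) n)) {..<N}) \<longlonglongrightarrow> L2_set (\<lambda>j. norm (x j)) {..<N}"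
    unfolding L2_set_def by (intro tendsto_intros ell1_norm_LIMSEQ)
  show ?thesis
  proof (rule LIMSEQ_le_const2[OF lim], intro exI allI impI)
    fix M :: nat
    let ?X = "\<lambda>\<epsilon>. \<Sum>j<N. \<epsilon> j *\<^sub>R x j"
    have "L2_set (\<lambda>j. \<Sum>n<M. norm (ell1_nth (x j) n)) {..<N}
        \<le> (\<Sum>n<M. L2_set (\<lambda>j. norm (ell1_nth (x j) n)) {..<N})" by (rule L2_set_sum_le)
    also have "\<dots> \<le> (\<Sum>n<M. 2 * ((\<Sum>\<epsilon>\<in>signs N. norm (ell1_nth (?X \<epsilon>) n)) / 2 ^ N))"
      unfolding L2_set_def ell1_nth_sum scaleR_ell1.rep_eq by (intro sum_mono khinchine_L1)
    also have "\<dots> = 2 * ((\<Sum>\<epsilon>\<in>signs N. \<Sum>n<M. norm (ell1_nth (?X \<epsilon>) n)) / 2 ^ N)"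
      by (subst sum.swap) (simp add: sum_distrib_left sum_divide_distrib)
    also have "\<dots> \<le> 2 * ((\<Sum>\<epsilon>\<in>signs N. norm (?X \<epsilon>)) / 2 ^ N)"
      by (intro mult_left_mono divide_right_mono sum_mono ell1_sum_le_norm) auto
    finally show "L2_set (\<lambda>j. \<Sum>n<M. norm (ell1_nth (x j) n)) {..<N}
        \<le> 2 * ((\<Sum>\<epsilon>\<in>signs N. norm (?X \<epsilon>)) / 2 ^ N)" .
  qed
qed

lemma mean_le_root_mean_square:
  assumes "finite A" "card A > 0"
  shows "(\<Sum>i\<in>A. f i) / card A \<le> sqrt ((\<Sum>i\<in>A. (f i)\<^sup>2) / card A)"
proof -
  have "(\<Sum>i\<in>A. f i) \<le> (\<Sum>i\<in>A. \<bar>1\<bar> * \<bar>f i\<bar>)" by (intro sum_mono) auto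
  also have "\<dots> \<le> L2_set (\<lambda>_. 1) A * L2_set f A" by (rule L2_set_mult_ineq)
  also have "\<dots> = sqrt (card A) * sqrt (\<Sum>i\<in>A. (f i)\<^sup>2)" by (simp add: L2_set_constant) (simp add: L2_set_def)
  finally have "(\<Sum>i\<in>A. f i) / card A \<le> sqrt (card A) * sqrt (\<Sum>i\<in>A. (f i)\<^sup>2) / card A"
    by (intro divide_right_mono) auto
  also have "\<dots> = sqrt ((\<Sum>i\<in>A. (f i)\<^sup>2) / card A)"
    using assms(2) by (simp add: real_sqrt_divide field_simps)
  finally show ?thesis .
qed

lemma ell1_cotype_2: "has_cotype 2 TYPE('k::{real_normed_field,euclidean_space} ell1)"
  unfolding has_cotype_def
proof (intro exI[of _ 2] conjI allI)
  fix N and x :: "nat \<Rightarrow> 'k ell1"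
  have "(\<Sum>j<N. norm (x j) powr 2) powr (1 / 2) = L2_set (\<lambda>j. norm (x j)) {..<N}"
    by (simp add: L2_set_def powr_half_sqrt sum_nonneg)
  also have "\<dots> \<le> 2 * ((\<Sum>\<epsilon>\<in>signs N. norm (\<Sum>j<N. \<epsilon> j *\<^sub>R x j)) / 2 ^ N)"
    by (rule ell1_signs_norm_ge)
  also have "\<dots> \<le> 2 * rademacher_norm N x"
    using mean_le_root_mean_square[of "signs N" "\<lambda>\<epsilon>. norm (\<Sum>j<N. \<epsilon> j *\<^sub>R x j)"]
    by (simp add: rademacher_norm_def card_signs flip: signs_def)
  finally show "(\<Sum>j<N. norm (x j) powr 2) powr (1 / 2) \<le> 2 * rademacher_norm N x" .
qed simp

lemma ell2_nth_sum: "ell2_nth (\<Sum>i\<in>I. f i) n = (\<Sum>i\<in>I. ell2_nth (f i) n)"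
  by (induction I rule: infinite_finite_induct) auto

text \<open>Orthogonality of the signs holds in each coordinate and survives the limit, which gives
  cotype 2 with constant 1.\<close>

lemma ell2_sum_signs_norm_power2:
  fixes x :: "nat \<Rightarrow> 'k::{real_normed_field,real_inner} ell2"
  shows "(\<Sum>\<epsilon>\<in>signs N. (norm (\<Sum>j<N. \<epsilon> j *\<^sub>R x j))\<^sup>2) = 2 ^ N * (\<Sum>j<N. (norm (x j))\<^sup>2)"
proof (rule LIMSEQ_unique)
  let ?X = "\<lambda>\<epsilon>. \<Sum>j<N. \<epsilon> j *\<^sub>R x j"
  show "(\<lambda>P. \<Sum>\<epsilon>\<in>signs N. \<Sum>n<P. (norm (ell2_nth (?X \<epsilon>) n))\<^sup>2) \<longlonglongrightarrow> (\<Sum>\<epsilon>\<in>signs N. (norm (?X \<epsilon>))\<^sup>2)"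
    by (intro tendsto_intros ell2_norm_power2_LIMSEQ)
  have "(\<Sum>\<epsilon>\<in>signs N. \<Sum>n<P. (norm (ell2_nth (?X \<epsilon>) n))\<^sup>2) = 2 ^ N * (\<Sum>j<N. \<Sum>n<P. (norm (ell2_nth (x j) n))\<^sup>2)" for P
    by (subst (1 2) sum.swap) (simp add: ell2_nth_sum sum_signs_norm_power2 sum_distrib_left)
  then show "(\<lambda>P. \<Sum>\<epsilon>\<in>signs N. \<Sum>n<P. (norm (ell2_nth (?X \<epsilon>) n))\<^sup>2) \<longlonglongrightarrow> 2 ^ N * (\<Sum>j<N. (norm (x j))\<^sup>2)"
    by (simp only:) (intro tendsto_intros ell2_norm_power2_LIMSEQ)
qed

lemma ell2_cotype_2: "has_cotype 2 TYPE('k::{real_normed_field,euclidean_space} ell2)"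
  unfolding has_cotype_def
proof (intro exI[of _ 1] conjI allI)
  fix N and x :: "nat \<Rightarrow> 'k ell2"
  show "(\<Sum>j<N. norm (x j) powr 2) powr (1 / 2) \<le> 1 * rademacher_norm N x"
    by (simp add: rademacher_norm_def ell2_sum_signs_norm_power2 powr_half_sqrt sum_nonneg flip: signs_def)
qed simp

section \<open>The optimal exponents\<close>

lemma abs_summing_maps_subset: "abs_summing_maps r sE sF m \<subseteq> multilinear_maps sE sF m"
  by (auto simp: abs_summing_maps_def)

text \<open>The infimum is attained: \<open>2 / m\<close> is itself a coincidence exponent.\<close>

lemma r_opt_ell1:
  assumes "m > 0"
  shows "r_opt m (scale_ell1 :: 'k::{real_normed_field,euclidean_space} \<Rightarrow> _) = ereal (2 / real m)"
  unfolding r_opt_def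
proof (rule antisym)
  let ?S = "{r::real. r > 0 \<and> multilinear_maps (scale_ell1 :: 'k \<Rightarrow> 'k ell1 \<Rightarrow> 'k ell1) (scale_ell1 :: 'k \<Rightarrow> _) m
      = abs_summing_maps r scale_ell1 scale_ell1 m}"
  have "2 / real m \<in> ?S"
    using assms multilinear_ell1_abs_summing[OF assms ell1.banach_space_over_axioms]
    by (auto intro: subsetD[OF abs_summing_maps_subset])
  then show "(INF r\<in>?S. ereal r) \<le> ereal (2 / real m)" by (rule INF_lower)
  show "ereal (2 / real m) \<le> (INF r\<in>?S. ereal r)"
    using ell1_exponent_ge[OF assms] by (intro INF_greatest) auto
qed

text \<open>Coincidence is available strictly above \<open>2 / (m + 1)\<close>, so a larger infimum
  is refuted by a real exponent between the two.\<close>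

lemma r_opt_ell2:
  assumes "m > 0"
  shows "r_opt m (scale_ell2 :: 'k::{real_normed_field,euclidean_space} \<Rightarrow> _) = ereal (2 / (real m + 1))"
  unfolding r_opt_def
proof (rule antisym)
  let ?S = "{r::real. r > 0 \<and> multilinear_maps (scale_ell1 :: 'k \<Rightarrow> 'k ell1 \<Rightarrow> 'k ell1) (scale_ell2 :: 'k \<Rightarrow> _) m
      = abs_summing_maps r scale_ell1 scale_ell2 m}"
  show "(INF r\<in>?S. ereal r) \<le> ereal (2 / (real m + 1))"
  proof (rule ccontr)
    assume "\<not> ?thesis"
    then have "ereal (2 / (real m + 1)) < (INF r\<in>?S. ereal r)" by (simp only: not_le)
    then obtain r where r: "ereal (2 / (real m + 1)) < ereal r" "ereal r < (INF r\<in>?S. ereal r)"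
      using ereal_dense2 by blast
    have "r > 2 / (real m + 1)" using r(1) by simp
    moreover from this have "r > 0" by (rule less_trans[rotated]) simp
    ultimately have "r \<in> ?S"
      using multilinear_ell2_abs_summing[OF _ assms] by (auto intro: subsetD[OF abs_summing_maps_subset])
    then have "(INF r\<in>?S. ereal r) \<le> ereal r" by (rule INF_lower)
    then show False using r(2) by simp
  qed
  show "ereal (2 / (real m + 1)) \<le> (INF r\<in>?S. ereal r)"
    using ell2_exponent_ge[OF assms] by (intro INF_greatest) auto
qed

theorem corollary5p4:
  fixes m :: nat
  assumes "m \<ge> 2"
  shows
    "(r_opt m (scale_ell1 :: real \<Rightarrow> real ell1 \<Rightarrow> real ell1) = ereal (2 / real m) \<and>
      r_opt m (scale_ell2 :: real \<Rightarrow> real ell2 \<Rightarrow> real ell2) = ereal (2 / (real m + 1)) \<and>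
      has_cotype 2 TYPE(real ell1) \<and> has_cotype 2 TYPE(real ell2) \<and>
      r_opt m (scale_ell1 :: real \<Rightarrow> real ell1 \<Rightarrow> real ell1) \<noteq>
      r_opt m (scale_ell2 :: real \<Rightarrow> real ell2 \<Rightarrow> real ell2)) \<and>
     (r_opt m (scale_ell1 :: complex \<Rightarrow> complex ell1 \<Rightarrow> complex ell1) = ereal (2 / real m) \<and>
      r_opt m (scale_ell2 :: complex \<Rightarrow> complex ell2 \<Rightarrow> complex ell2) = ereal (2 / (real m + 1)) \<and>
      has_cotype 2 TYPE(complex ell1) \<and> has_cotype 2 TYPE(complex ell2) \<and>
      r_opt m (scale_ell1 :: complex \<Rightarrow> complex ell1 \<Rightarrow> complex ell1) \<noteq>
      r_opt m (scale_ell2 :: complex \<Rightarrow> complex ell2 \<Rightarrow> complex ell2))"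
proof -
  have "m > 0" using assms by simp
  then have "ereal (2 / real m) \<noteq> ereal (2 / (real m + 1))" by (simp add: field_simps)
  then show ?thesis
    unfolding r_opt_ell1[OF \<open>m > 0\<close>] r_opt_ell2[OF \<open>m > 0\<close>]
    by (intro conjI refl ell1_cotype_2 ell2_cotype_2)
qed

end
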